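(* Assume the standing setting below, and assume in addition that $D(A_2)\subset D(A_1^{1/2})$ and there is $c>0$ with $|A_1^{1/2}u|\le c|A_2u|$ for all $u\in D(A_2)$. Then there is a constant $c_1>0$ such that for every $U_0\in D(\mathcal A^4)$ the solution $U(t)=e^{t\mathcal A}U_0$ satisfies $$\int_0^T\mathcal E(U(t))\,dt\le c_1\sum_{k=0}^{4}\mathcal E(U^{(k)}(0))\qquad\forall\,T>0,$$ where $U^{(k)}(0)=\mathcal A^kU_0$.
   Context: Standing setting: $H$ is a real Hilbert space with inner product $\langle\cdot,\cdot\rangle$ and norm $|\cdot|$. $A_1,A_2$ are densely defined closed self-adjoint operators on $H$ with $\langle A_iu,u\rangle\ge\omega_i|u|^2$ for $u\in D(A_i)$, for some $\omega_1,\omega_2>0$; $A_i^{s}$ denote their fractional powers. $B$ is a bounded self-adjoint operator on $H$ with $\langle Bu,u\rangle\ge\beta|u|^2$ for all $u\in H$, for some $\beta>0$. $\alpha\in\mathbb R$ satisfies $0<|\alpha|<\sqrt{\omega_1\omega_2}$. Let $\mathcal H=D(A_1^{1/2})\times H\times D(A_2^{1/2})\times H$ with the inner product $(U|\widehat U)=\langle A_1^{1/2}u,A_1^{1/2}\widehat u\rangle+\langle p,\widehat p\rangle+\langle A_2^{1/2}v,A_2^{1/2}\widehat v\rangle+\langle q,\widehat q\rangle+\alpha\langle u,\widehat v\rangle+\alpha\langle v,\widehat u\rangle$ for $U=(u,p,v,q)$, $\widehat U=(\widehat u,\widehat p,\widehat v,\widehat q)$ (this makes $\mathcal H$ a Hilbert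 space). Set $E_i(u,p)=\frac12(|A_i^{1/2}u|^2+|p|^2)$ and $\mathcal E(U)=E_1(u,p)+E_2(v,q)+\alpha\langle u,v\rangle=\frac12(U|U)$. Define $\mathcal A$ on $D(\mathcal A)=D(A_1)\times D(A_1^{1/2})\times D(A_2)\times D(A_2^{1/2})$ by $\mathcal AU=(p,-A_1u-Bp-\alpha v,q,-A_2v-\alpha u)$. $\mathcal A$ generates a $C_0$-semigroup $e^{t\mathcal A}$ of contractions on $\mathcal H$, and $U(t)=e^{t\mathcal A}U_0=(u(t),u'(t),v(t),v'(t))$ corresponds to the solution of $u''+A_1u+Bu'+\alpha v=0$, $v''+A_2v+\alpha u=0$ with initial data $U_0=(u(0),u'(0),v(0),v'(0))$. *)

theory Defs
  imports "HOL-Analysis.Analysis"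
begin

text \<open>An unbounded operator on a real Hilbert space is a pair (domain D, map A).\<close>

definition lin_op :: "'a::real_vector set \<Rightarrow> ('a \<Rightarrow> 'a) \<Rightarrow> bool" where
  "lin_op D A \<longleftrightarrow> subspace D \<and>
     (\<forall>x\<in>D. \<forall>y\<in>D. A (x + y) = A x + A y) \<and> (\<forall>c. \<forall>x\<in>D. A (c *\<^sub>R x) = c *\<^sub>R A x)"

definition adjoint_dom :: "'a::real_inner set \<Rightarrow> ('a \<Rightarrow> 'a) \<Rightarrow> 'a set" where
  "adjoint_dom D A = {y. \<exists>z. \<forall>x\<in>D. inner (A x) y = inner x z}"

definition densely_defined :: "'a::real_normed_vector set \<Rightarrow> bool" where
  "densely_defined D \<longleftrightarrow> closure D = UNIV"

definition closed_op :: "'a::real_normed_vector set \<Rightarrow> ('a \<Rightarrow> 'a) \<Rightarrow> bool" where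
  "closed_op D A \<longleftrightarrow> closed {(x, A x) | x. x \<in> D}"

definition selfadjoint_op :: "'a::real_inner set \<Rightarrow> ('a \<Rightarrow> 'a) \<Rightarrow> bool" where
  "selfadjoint_op D A \<longleftrightarrow> densely_defined D \<and> lin_op D A \<and>
     adjoint_dom D A = D \<and> (\<forall>x\<in>D. \<forall>y\<in>D. inner (A x) y = inner x (A y))"

text \<open>(DS, S) is the square root A^(1/2) of (DA, A): the nonnegative self-adjoint operator
  whose square is A (unique for a nonnegative self-adjoint A).\<close>
definition is_sqrt_op :: "'a::real_inner set \<Rightarrow> ('a \<Rightarrow> 'a) \<Rightarrow> 'a set \<Rightarrow> ('a \<Rightarrow> 'a) \<Rightarrow> bool" where
  "is_sqrt_op DA A DS S \<longleftrightarrow> selfadjoint_op DS S \<and> (\<forall>u\<in>DS. inner (S u) u \<ge> 0) \<and>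
     DA = {u \<in> DS. S u \<in> DS} \<and> (\<forall>u\<in>DA. A u = S (S u))"

text \<open>The energy space \<H> = D(A1^(1/2)) x H x D(A2^(1/2)) x H, its inner product, norm, energy.\<close>
type_synonym 'a st = "'a \<times> 'a \<times> 'a \<times> 'a"

definition Hsp :: "'a set \<Rightarrow> 'a set \<Rightarrow> 'a st set" where
  "Hsp DS1 DS2 = DS1 \<times> UNIV \<times> DS2 \<times> UNIV"

definition hinner :: "('a::real_inner \<Rightarrow> 'a) \<Rightarrow> ('a \<Rightarrow> 'a) \<Rightarrow> real \<Rightarrow> 'a st \<Rightarrow> 'a st \<Rightarrow> real" where
  "hinner S1 S2 \<alpha> U W = (case U of (u, p, v, q) \<Rightarrow> case W of (u', p', v', q') \<Rightarrow>
      inner (S1 u) (S1 u') + inner p p' + inner (S2 v) (S2 v') + inner q q'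
      + \<alpha> * inner u v' + \<alpha> * inner v u')"

definition hnorm :: "('a::real_inner \<Rightarrow> 'a) \<Rightarrow> ('a \<Rightarrow> 'a) \<Rightarrow> real \<Rightarrow> 'a st \<Rightarrow> real" where
  "hnorm S1 S2 \<alpha> U = sqrt (hinner S1 S2 \<alpha> U U)"

definition energy :: "('a::real_inner \<Rightarrow> 'a) \<Rightarrow> ('a \<Rightarrow> 'a) \<Rightarrow> real \<Rightarrow> 'a st \<Rightarrow> real" where
  "energy S1 S2 \<alpha> U = hinner S1 S2 \<alpha> U U / 2"

definition opA_dom :: "'a set \<Rightarrow> 'a set \<Rightarrow> 'a set \<Rightarrow> 'a set \<Rightarrow> 'a st set" where
  "opA_dom DA1 DS1 DA2 DS2 = DA1 \<times> DS1 \<times> DA2 \<times> DS2"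

definition opA :: "('a::real_vector \<Rightarrow> 'a) \<Rightarrow> ('a \<Rightarrow> 'a) \<Rightarrow> ('a \<Rightarrow> 'a) \<Rightarrow> real \<Rightarrow> 'a st \<Rightarrow> 'a st" where
  "opA A1 A2 B \<alpha> U = (case U of (u, p, v, q) \<Rightarrow>
      (p, - A1 u - B p - \<alpha> *\<^sub>R v, q, - A2 v - \<alpha> *\<^sub>R u))"

text \<open>T is a C0-semigroup of bounded linear operators on the normed space (X, N)
  (X a subspace of the real vector space 'b carrying the norm N), with generator (D, G).\<close>
definition C0_semigroup_gen ::
  "'b::real_vector set \<Rightarrow> ('b \<Rightarrow> real) \<Rightarrow> (real \<Rightarrow> 'b \<Rightarrow> 'b) \<Rightarrow> 'b set \<Rightarrow> ('b \<Rightarrow> 'b) \<Rightarrow> bool" where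
  "C0_semigroup_gen X N T D G \<longleftrightarrow>
     (\<forall>t\<ge>0. \<forall>x\<in>X. T t x \<in> X) \<and>
     (\<forall>t\<ge>0. lin_op X (T t) \<and> (\<exists>M. \<forall>x\<in>X. N (T t x) \<le> M * N x)) \<and>
     (\<forall>x\<in>X. T 0 x = x) \<and>
     (\<forall>s\<ge>0. \<forall>t\<ge>0. \<forall>x\<in>X. T (s + t) x = T s (T t x)) \<and>
     (\<forall>x\<in>X. ((\<lambda>t. N (T t x - x)) \<longlongrightarrow> 0) (at_right 0)) \<and>
     D \<subseteq> X \<and>
     (\<forall>x\<in>X. x \<in> D \<longleftrightarrow>
        (\<exists>y\<in>X. ((\<lambda>h. N ((1 / h) *\<^sub>R (T h x - x) - y)) \<longlongrightarrow> 0) (at_right 0))) \<and>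
     (\<forall>x\<in>D. G x \<in> X \<and> ((\<lambda>h. N ((1 / h) *\<^sub>R (T h x - x) - G x)) \<longlongrightarrow> 0) (at_right 0))"

end

theory Submission
  imports Defs
begin

text \<open>Dissipation controls \<open>u', \<dots>, u\<^sup>(\<^sup>5\<^sup>)\<close> in \<open>L\<^sup>2(0, T; H)\<close> by the energies of
  \<open>U, U', \<dots>, U\<^sup>(\<^sup>4\<^sup>)\<close>. The velocity \<open>v'\<close> is not damped; it is recovered from the differentiated first
  equation, \<open>\<alpha>v' = - u''' - Bu'' - A\<^sub>1u'\<close>, tested with \<open>v'\<close>. In the term
  \<open>\<langle>A\<^sub>1\<^sup>1\<^sup>/\<^sup>2u', A\<^sub>1\<^sup>1\<^sup>/\<^sup>2v'\<rangle>\<close> the second equation gives \<open>A\<^sub>1\<^sup>1\<^sup>/\<^sup>2v' = - R(v''' + \<alpha>u')\<close>, where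
  \<open>R = A\<^sub>1\<^sup>1\<^sup>/\<^sup>2A\<^sub>2\<^sup>-\<^sup>1\<close> is bounded by hypothesis, and two integrations by parts move the
  derivatives from \<open>v'''\<close> to \<open>u\<close>. This costs \<open>A\<^sub>1\<^sup>1\<^sup>/\<^sup>2u'''\<close>, which is estimated by testing the
  first equation, differentiated three times, with \<open>u'''\<close>; there again \<open>\<langle>v''', u'''\<rangle>\<close> is
  integrated by parts to \<open>\<langle>v', u\<^sup>(\<^sup>5\<^sup>)\<rangle>\<close>. Finally, testing the original equations with \<open>u\<close> and
  \<open>v\<close> bounds the energy by \<open>\<parallel>u'\<parallel>\<^sup>2 + \<parallel>v'\<parallel>\<^sup>2\<close> up to a time derivative.\<close>

section \<open>Coercive self-adjoint operators and square roots\<close>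

lemma lin_op_diff:
  assumes "lin_op D K" "x \<in> D" "y \<in> D"
  shows "K (x - y) = K x - K y"
proof -
  have "(-1) *\<^sub>R y \<in> D" using assms by (intro subspace_scale) (auto simp: lin_op_def)
  then have "K (x + (-1) *\<^sub>R y) = K x + (-1) *\<^sub>R K y"
    using assms unfolding lin_op_def by metis
  then show ?thesis by simp
qed

lemma parallelogram_law:
  fixes x y :: "'a::real_inner"
  shows "(norm (x - y))\<^sup>2 + (norm (x + y))\<^sup>2 = 2 * (norm x)\<^sup>2 + 2 * (norm y)\<^sup>2"
  by (simp add: power2_norm_eq_inner inner_diff inner_add inner_commute)

lemma norm_diff_scaleR_square:
  fixes w x :: "'a::real_inner"
  shows "(norm (w - t *\<^sub>R x))\<^sup>2 = (norm w)\<^sup>2 - 2 * t * inner x w + t\<^sup>2 * (norm x)\<^sup>2"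
  unfolding power2_norm_eq_inner
  by (simp add: inner_diff_left inner_diff_right inner_commute[of w x] power2_eq_square algebra_simps)

text \<open>A minimizing sequence for the distance from some \<open>y\<close> outside
  \<open>M\<close> is Cauchy by the parallelogram law. Its limit \<open>l\<close> is the foot of the
  perpendicular, and \<open>y - l\<close> is the vector sought.\<close>

lemma closed_subspace_orthogonal_vector:
  fixes M :: "'a::{real_inner, complete_space} set"
  assumes M: "subspace M" "closed M" "M \<noteq> UNIV"
  obtains z where "z \<noteq> 0" "\<And>x. x \<in> M \<Longrightarrow> inner x z = 0"
proof -
  obtain y where y: "y \<notin> M" using M(3) by blast
  define d where "d = infdist y M"
  have ne: "M \<noteq> {}" using subspace_0[OF M(1)] by auto
  have dle: "d \<le> norm (y - x)" if "x \<in> M" for x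
    using infdist_le[OF that, of y] by (simp add: d_def dist_norm)
  have d0: "0 \<le> d" by (simp add: d_def infdist_nonneg)
  have "\<exists>x\<in>M. norm (y - x) < d + 1 / (Suc n)" for n
  proof (rule ccontr)
    assume "\<not> ?thesis"
    then have "d + 1 / (Suc n) \<le> infdist y M"
      unfolding infdist_notempty[OF ne] by (intro cINF_greatest[OF ne]) (auto simp: dist_norm not_less)
    then show False by (simp add: d_def field_simps)
  qed
  then obtain f where f: "\<And>n. f n \<in> M" "\<And>n. norm (y - f n) < d + 1 / (Suc n)" by metis
  have lim1: "(\<lambda>n. norm (y - f n)) \<longlonglongrightarrow> d"
  proof (rule tendsto_sandwich[where f = "\<lambda>_. d" and h = "\<lambda>n. d + 1 / (Suc n)"])
    show "(\<lambda>n. d + 1 / real (Suc n)) \<longlonglongrightarrow> d"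
      using tendsto_add[OF tendsto_const LIMSEQ_inverse_real_of_nat, of d]
      by (simp add: inverse_eq_divide)
  qed (use dle f less_imp_le[OF f(2)] in \<open>auto intro!: always_eventually simp del: of_nat_Suc\<close>)
  define r where "r n = (norm (y - f n))\<^sup>2 - d\<^sup>2" for n
  have est: "(norm (f m - f n))\<^sup>2 \<le> 2 * r m + 2 * r n" for m n
  proof -
    \<comment> \<open>The midpoint of \<open>f m\<close> and \<open>f n\<close> stays in
      \<open>M\<close>, hence at distance at least \<open>d\<close> from \<open>y\<close>; the
      parallelogram law turns this into a bound on \<open>f m - f n\<close>.\<close>
    have mid: "(1/2) *\<^sub>R (f m + f n) \<in> M" using M(1) f(1) by (simp add: subspace_scale subspace_add)
    have "(2 * d)\<^sup>2 \<le> (2 * norm (y - (1/2) *\<^sub>R (f m + f n)))\<^sup>2"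
      using dle[OF mid] d0 by (intro power_mono) auto
    also have "2 * norm (y - (1/2) *\<^sub>R (f m + f n)) = norm (2 *\<^sub>R (y - (1/2) *\<^sub>R (f m + f n)))" by simp
    also have "2 *\<^sub>R (y - (1/2) *\<^sub>R (f m + f n)) = (y - f m) + (y - f n)"
      by (simp add: algebra_simps scaleR_2)
    finally have "4 * d\<^sup>2 \<le> (norm ((y - f m) + (y - f n)))\<^sup>2" by (simp add: power_mult_distrib)
    moreover have "(norm ((y - f m) - (y - f n)))\<^sup>2 = (norm (f m - f n))\<^sup>2"
      by (simp add: norm_minus_commute)
    ultimately show ?thesis using parallelogram_law[of "y - f m" "y - f n"] by (simp add: r_def del: diff_diff_eq diff_diff_eq2)
  qed
  have "Cauchy f"
  proof (rule CauchyI)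
    fix e :: real assume e: "e > 0"
    have "r \<longlonglongrightarrow> d\<^sup>2 - d\<^sup>2" unfolding r_def by (intro tendsto_intros lim1)
    then have "eventually (\<lambda>n. r n < e\<^sup>2 / 4) sequentially"
      by (rule order_tendstoD(2)) (use e in simp)
    then obtain N where N: "\<And>n. n \<ge> N \<Longrightarrow> r n < e\<^sup>2 / 4"
      by (auto simp: eventually_sequentially)
    show "\<exists>N. \<forall>m\<ge>N. \<forall>n\<ge>N. norm (f m - f n) < e"
    proof (intro exI allI impI)
      fix m n assume mn: "m \<ge> N" "n \<ge> N"
      have "(norm (f m - f n))\<^sup>2 < e\<^sup>2" using est[of m n] N[OF mn(1)] N[OF mn(2)] by linarith
      then show "norm (f m - f n) < e" by (rule power_less_imp_less_base) (use e in simp)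
    qed
  qed
  then obtain l where l: "f \<longlonglongrightarrow> l" using Cauchy_convergent convergent_def by blast
  then have lM: "l \<in> M" using M(2) f(1) closed_sequentially by blast
  have "(\<lambda>n. norm (y - f n)) \<longlonglongrightarrow> norm (y - l)" by (intro tendsto_intros l)
  then have nl: "norm (y - l) = d" using lim1 LIMSEQ_unique by blast
  have "inner x (y - l) = 0" if x: "x \<in> M" for x
  proof (cases "x = 0")
    case False
    \<comment> \<open>This \<open>t\<close> minimizes the distance from \<open>y\<close> to the line
      through \<open>l\<close> with direction \<open>x\<close>, so a nonzero inner product would
      push the distance below \<open>d\<close>.\<close>
    define t where "t = inner x (y - l) / (norm x)\<^sup>2"
    have "l + t *\<^sub>R x \<in> M" using M(1) lM x by (simp add: subspace_scale subspace_add)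
    then have "d\<^sup>2 \<le> (norm (y - (l + t *\<^sub>R x)))\<^sup>2" using dle d0 by (intro power_mono) auto
    also have "\<dots> = (norm ((y - l) - t *\<^sub>R x))\<^sup>2" by (simp add: diff_diff_eq)
    also have "\<dots> = d\<^sup>2 - 2 * t * inner x (y - l) + t\<^sup>2 * (norm x)\<^sup>2"
      using norm_diff_scaleR_square[of "y - l" t x] by (simp only: nl)
    also have "\<dots> = d\<^sup>2 - (inner x (y - l))\<^sup>2 / (norm x)\<^sup>2"
      using False by (simp add: t_def power2_eq_square field_simps)
    finally show ?thesis using False by (simp add: divide_le_0_iff)
  qed auto
  moreover have "y - l \<noteq> 0" using lM y by auto
  ultimately show ?thesis using that by blast
qed

text \<open>Coercivity bounds \<open>K\<close> from below, so its range is closed. A vector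
  \<open>z\<close> orthogonal to the range lies in the adjoint domain, hence in \<open>D\<close>,
  and testing \<open>K z\<close> with \<open>z\<close> forces \<open>z = 0\<close>.\<close>

lemma selfadjoint_coercive_surj:
  fixes K :: "'a::{real_inner, complete_space} \<Rightarrow> 'a"
  assumes sa: "selfadjoint_op D K" and m: "m > 0"
    and coer: "\<And>x. x \<in> D \<Longrightarrow> m * (norm x)\<^sup>2 \<le> inner (K x) x"
  shows "K ` D = UNIV"
proof (rule ccontr)
  assume nU: "K ` D \<noteq> UNIV"
  have D: "subspace D" and add: "\<And>x y. x \<in> D \<Longrightarrow> y \<in> D \<Longrightarrow> K (x + y) = K x + K y"
    and scale: "\<And>c x. x \<in> D \<Longrightarrow> K (c *\<^sub>R x) = c *\<^sub>R K x"
    and adj: "adjoint_dom D K = D"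
    and sym: "\<And>x y. x \<in> D \<Longrightarrow> y \<in> D \<Longrightarrow> inner (K x) y = inner x (K y)"
    and dense: "closure D = UNIV"
    using sa by (auto simp: selfadjoint_op_def lin_op_def densely_defined_def)
  have diff: "K (x - y) = K x - K y" if "x \<in> D" "y \<in> D" for x y
    using sa that by (auto simp: selfadjoint_op_def intro: lin_op_diff)
  have below: "m * norm x \<le> norm (K x)" if "x \<in> D" for x
  proof (cases "x = 0")
    case False
    have "m * norm x * norm x \<le> norm (K x) * norm x"
      using coer[OF that] norm_cauchy_schwarz[of "K x" x] by (simp add: power2_eq_square)
    then show ?thesis using False by simp
  qed auto
  have sub: "subspace (K ` D)"
  proof (rule subspaceI)
    show "0 \<in> K ` D" using scale[of 0 0] subspace_0[OF D] by (auto intro!: image_eqI[of _ _ 0])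
  next
    fix x y assume "x \<in> K ` D" "y \<in> K ` D"
    then show "x + y \<in> K ` D" by (auto simp: add[symmetric] subspace_add[OF D])
  next
    fix x c assume "x \<in> K ` D"
    then show "c *\<^sub>R x \<in> K ` D" by (auto simp: scale[symmetric] subspace_scale[OF D])
  qed
  have "closed (K ` D)"
    unfolding closed_sequential_limits
  proof (intro allI impI, elim conjE)
    fix g y assume g: "\<forall>n. g n \<in> K ` D" and lim: "g \<longlonglongrightarrow> y"
    then have "\<forall>n. \<exists>x. x \<in> D \<and> g n = K x" by blast
    then obtain x where x: "\<And>n. x n \<in> D" "\<And>n. g n = K (x n)" by metis
    have "Cauchy g" using lim by (simp add: LIMSEQ_imp_Cauchy)
    have "Cauchy x"
    proof (rule CauchyI)
      fix e :: real assume "e > 0"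
      then have "m * e > 0" using m by simp
      then obtain N where N: "\<And>i j. i \<ge> N \<Longrightarrow> j \<ge> N \<Longrightarrow> norm (g i - g j) < m * e"
        using CauchyD[OF \<open>Cauchy g\<close>] by blast
      show "\<exists>N. \<forall>i\<ge>N. \<forall>j\<ge>N. norm (x i - x j) < e"
      proof (intro exI allI impI)
        fix i j assume "i \<ge> N" "j \<ge> N"
        from N[OF this] have "m * norm (x i - x j) < m * e"
          using below[OF subspace_diff[OF D x(1) x(1)], of i j] diff[OF x(1) x(1), of i j]
          by (simp add: x(2))
        then show "norm (x i - x j) < e" using m by simp
      qed
    qed
    then obtain l where l: "x \<longlonglongrightarrow> l" using Cauchy_convergent convergent_def by blast
    \<comment> \<open>Symmetry passes to the limit and places \<open>l\<close> in the adjoint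
      domain, which is \<open>D\<close>. Density of \<open>D\<close> then identifies
      \<open>K l\<close> with \<open>y\<close>.\<close>
    have id: "inner (K w) l = inner w y" if w: "w \<in> D" for w
    proof (rule LIMSEQ_unique)
      show "(\<lambda>n. inner (K w) (x n)) \<longlonglongrightarrow> inner (K w) l" by (intro tendsto_intros l)
      have "(\<lambda>n. inner w (g n)) \<longlonglongrightarrow> inner w y" by (intro tendsto_intros lim)
      then show "(\<lambda>n. inner (K w) (x n)) \<longlonglongrightarrow> inner w y" using sym[OF w x(1)] x(2) by simp
    qed
    then have "l \<in> adjoint_dom D K" by (auto simp: adjoint_dom_def)
    then have lD: "l \<in> D" using adj by simp
    have "inner w (K l - y) = 0" if "w \<in> D" for w
      using id[OF that] sym[OF that lD] by (simp add: inner_diff_right)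
    then have "D \<subseteq> {w. inner w (K l - y) = 0}" by auto
    moreover have "closed {w. inner w (K l - y) = 0}"
      by (intro closed_Collect_eq continuous_intros)
    ultimately have "closure D \<subseteq> {w. inner w (K l - y) = 0}" by (rule closure_minimal)
    then have "K l - y \<in> {w. inner w (K l - y) = 0}" unfolding dense by (rule subsetD) simp
    then show "y \<in> K ` D" using lD by auto
  qed
  then obtain z where z: "z \<noteq> 0" "\<And>x. x \<in> K ` D \<Longrightarrow> inner x z = 0"
    using closed_subspace_orthogonal_vector[OF sub _ nU] by blast
  then have "z \<in> adjoint_dom D K" by (auto simp: adjoint_dom_def intro!: exI[of _ 0])
  then have "z \<in> D" using adj by simp
  then have "m * (norm z)\<^sup>2 \<le> 0" using coer[of z] z(2)[of "K z"] by simp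
  then show False using m z(1) by (simp add: mult_le_0_iff)
qed

text \<open>Serves to invert \<open>S1\<close>, \<open>S2\<close> and \<open>A2\<close>: the lower
  bound yields both injectivity and the norm bound \<open>1 / m\<close> of the inverse.\<close>

lemma
  fixes K :: "'a::real_inner \<Rightarrow> 'a"
  assumes lin: "lin_op D K" and surj: "K ` D = UNIV" and m: "m > 0"
    and below: "\<And>x. x \<in> D \<Longrightarrow> m * norm x \<le> norm (K x)"
  shows bounded_linear_inv_into: "bounded_linear (inv_into D K)"
    and inv_into_coercive: "x \<in> D \<Longrightarrow> inv_into D K (K x) = x"
proof -
  have D: "subspace D" and add: "\<And>x y. x \<in> D \<Longrightarrow> y \<in> D \<Longrightarrow> K (x + y) = K x + K y"
    and scale: "\<And>c x. x \<in> D \<Longrightarrow> K (c *\<^sub>R x) = c *\<^sub>R K x"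
    using lin by (auto simp: lin_op_def)
  note diff = lin_op_diff[OF lin]
  have inj: "inj_on K D"
  proof (rule inj_onI)
    fix x y assume "x \<in> D" "y \<in> D" "K x = K y"
    then show "x = y" using below[of "x - y"] diff[of x y] subspace_diff[OF D] m
      by (auto simp: mult_le_0_iff)
  qed
  define I where "I = inv_into D K"
  have ID: "I y \<in> D" and KI: "K (I y) = y" for y
    using surj inv_into_into[of y K D] f_inv_into_f[of y K D] by (auto simp: I_def)
  have IK: "I (K x) = x" if "x \<in> D" for x using inj that by (simp add: I_def)
  show "bounded_linear (inv_into D K)"
    unfolding I_def[symmetric]
  proof (rule bounded_linear_intro[of _ "1 / m"])
    show "I (x + y) = I x + I y" for x y
      using IK[of "I x + I y"] add[OF ID ID] KI subspace_add[OF D ID ID] by simp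
    show "I (r *\<^sub>R x) = r *\<^sub>R I x" for r x
      using IK[of "r *\<^sub>R I x"] scale[OF ID] KI subspace_scale[OF D ID] by simp
    show "norm (I x) \<le> norm x * (1 / m)" for x
      using below[OF ID[of x]] KI[of x] m by (simp add: field_simps)
  qed
  show "x \<in> D \<Longrightarrow> inv_into D K (K x) = x" using IK by (simp add: I_def)
qed

text \<open>Coercivity of \<open>S\<^sup>2\<close> passes to the form domain of \<open>S\<close>: approximate \<open>u\<close> by
  \<open>w = (1 + \<epsilon>S)\<^sup>-\<^sup>1 u\<close>, which lies in the domain of \<open>S\<^sup>2\<close> and satisfies \<open>\<parallel>S w\<parallel> \<le> \<parallel>S u\<parallel>\<close>.\<close>

lemma sqrt_op_coercive:
  fixes S :: "'a::{real_inner, complete_space} \<Rightarrow> 'a"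
  assumes sq: "is_sqrt_op DA A DS S" and om: "\<omega> > 0"
    and coer: "\<And>u. u \<in> DA \<Longrightarrow> \<omega> * (norm u)\<^sup>2 \<le> inner (A u) u"
    and u: "u \<in> DS"
  shows "\<omega> * (norm u)\<^sup>2 \<le> (norm (S u))\<^sup>2"
proof -
  have sa: "selfadjoint_op DS S" and pos: "\<And>u. u \<in> DS \<Longrightarrow> inner (S u) u \<ge> 0"
    and DA: "DA = {u \<in> DS. S u \<in> DS}" and A: "\<And>u. u \<in> DA \<Longrightarrow> A u = S (S u)"
    using sq by (auto simp: is_sqrt_op_def)
  have D: "subspace DS" and add: "\<And>x y. x \<in> DS \<Longrightarrow> y \<in> DS \<Longrightarrow> S (x + y) = S x + S y"
    and scale: "\<And>c x. x \<in> DS \<Longrightarrow> S (c *\<^sub>R x) = c *\<^sub>R S x"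
    and adj: "adjoint_dom DS S = DS"
    and sym: "\<And>x y. x \<in> DS \<Longrightarrow> y \<in> DS \<Longrightarrow> inner (S x) y = inner x (S y)"
    and dense: "closure DS = UNIV"
    using sa by (auto simp: selfadjoint_op_def lin_op_def densely_defined_def)
  have key: "sqrt \<omega> * (norm u - \<epsilon> * norm (S u)) \<le> norm (S u)" if e: "\<epsilon> > 0" for \<epsilon>
  proof -
    define K where "K x = x + \<epsilon> *\<^sub>R S x" for x
    have adjK: "adjoint_dom DS K \<subseteq> DS"
    proof
      fix y assume "y \<in> adjoint_dom DS K"
      then obtain z where z: "\<And>x. x \<in> DS \<Longrightarrow> inner (K x) y = inner x z" by (auto simp: adjoint_dom_def)
      have "inner (S x) y = inner x ((1/\<epsilon>) *\<^sub>R (z - y))" if "x \<in> DS" for x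
        using z[OF that] e by (simp add: K_def inner_add_left inner_diff_right field_simps)
      then have "y \<in> adjoint_dom DS S" unfolding adjoint_dom_def by blast
      then show "y \<in> DS" using adj by simp
    qed
    have symK: "inner (K x) y = inner x (K y)" if "x \<in> DS" "y \<in> DS" for x y
      using sym[OF that] by (simp add: K_def inner_add_left inner_add_right)
    have adjK2: "DS \<subseteq> adjoint_dom DS K" using symK by (auto simp: adjoint_dom_def)
    have "selfadjoint_op DS K"
      unfolding selfadjoint_op_def lin_op_def densely_defined_def
      using equalityI[OF adjK adjK2] symK dense D by (auto simp: K_def add scale scaleR_add_right)
    then have "K ` DS = UNIV"
    proof (rule selfadjoint_coercive_surj[where m = 1])
      fix x assume "x \<in> DS"
      then show "1 * (norm x)\<^sup>2 \<le> inner (K x) x" using pos[of x] e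
        by (simp add: K_def inner_add_left power2_norm_eq_inner)
    qed simp
    then obtain w where w: "w \<in> DS" and Kw: "K w = u" by (metis UNIV_I imageE)
    have Sw: "S w = (1/\<epsilon>) *\<^sub>R (u - w)" using Kw e by (auto simp: K_def)
    have SwD: "S w \<in> DS" unfolding Sw using D u w by (simp add: subspace_scale subspace_diff)
    then have wA: "w \<in> DA" using w DA by simp
    \<comment> \<open>Applying \<open>S\<close> to \<open>u = w + \<epsilon> S w\<close> and pairing
      with \<open>S w\<close> leaves an extra term that is nonnegative because \<open>S\<close> is;
      this gives \<open>norm (S w) \<le> norm (S u)\<close>.\<close>
    have "S u = S w + \<epsilon> *\<^sub>R S (S w)" using Kw add[OF w] scale[OF SwD] SwD subspace_scale[OF D SwD]
      by (metis K_def)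
    then have "inner (S u) (S w) = (norm (S w))\<^sup>2 + \<epsilon> * inner (S (S w)) (S w)"
      by (simp add: inner_add_left power2_norm_eq_inner)
    moreover have "0 \<le> \<epsilon> * inner (S (S w)) (S w)" using pos[OF SwD] e by simp
    ultimately have "norm (S w) * norm (S w) \<le> norm (S u) * norm (S w)"
      using norm_cauchy_schwarz[of "S u" "S w"] by (simp add: power2_eq_square)
    then have le: "norm (S w) \<le> norm (S u)" by (cases "norm (S w) = 0") auto
    have "\<omega> * (norm w)\<^sup>2 \<le> (norm (S w))\<^sup>2"
      using coer[OF wA] A[OF wA] sym[OF SwD w] by (simp add: power2_norm_eq_inner)
    then have "(sqrt \<omega> * norm w)\<^sup>2 \<le> (norm (S w))\<^sup>2"
      using om by (simp add: power_mult_distrib)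
    then have "sqrt \<omega> * norm w \<le> norm (S w)" by (rule power2_le_imp_le) simp
    moreover have "norm u \<le> norm w + \<epsilon> * norm (S w)"
      using Kw norm_triangle_ineq[of w "\<epsilon> *\<^sub>R S w"] e by (simp add: K_def)
    ultimately have "norm u - \<epsilon> * norm (S u) \<le> norm w"
      using mult_left_mono[OF le, of \<epsilon>] e by linarith
    then have "sqrt \<omega> * (norm u - \<epsilon> * norm (S u)) \<le> sqrt \<omega> * norm w"
      using om by (intro mult_left_mono) auto
    with \<open>sqrt \<omega> * norm w \<le> norm (S w)\<close> le show ?thesis by linarith
  qed
  have "((\<lambda>\<epsilon>. sqrt \<omega> * (norm u - \<epsilon> * norm (S u))) \<longlongrightarrow> sqrt \<omega> * (norm u - 0 * norm (S u))) (at_right 0)"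
    by (intro tendsto_intros)
  then have "sqrt \<omega> * (norm u - 0 * norm (S u)) \<le> norm (S u)"
    by (rule tendsto_upperbound) (auto simp: eventually_at_right_field intro!: exI[of _ 1] key)
  then have "(sqrt \<omega> * norm u)\<^sup>2 \<le> (norm (S u))\<^sup>2" using om by (intro power_mono) auto
  then show ?thesis using om by (simp add: power_mult_distrib)
qed

section \<open>Strongly continuous semigroups\<close>

locale c0_semigroup =
  fixes V :: "real \<Rightarrow> 'b::{real_normed_vector, complete_space} \<Rightarrow> 'b"
  assumes bl: "0 \<le> t \<Longrightarrow> bounded_linear (V t)"
    and zero [simp]: "V 0 x = x"
    and add: "0 \<le> s \<Longrightarrow> 0 \<le> t \<Longrightarrow> V (s + t) x = V s (V t x)"
    and right_cont: "((\<lambda>t. V t x) \<longlongrightarrow> x) (at_right 0)"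
begin

text \<open>Right continuity bounds each orbit on some short interval, so the closed sets
  \<open>A n\<close> cover the space. By Baire one of them contains a ball, and linearity spreads
  the bound from that ball to all vectors.\<close>

lemma bounded_near_zero:
  "\<exists>\<delta>>0. \<exists>M. \<forall>t\<in>{0..\<delta>}. \<forall>x. norm (V t x) \<le> M * norm x"
proof -
  define A where "A n = {x. \<forall>t\<in>{0..1 / real (Suc n)}. norm (V t x) \<le> real n}" for n
  have "closed (A n)" for n
  proof -
    have "A n = (\<Inter>t\<in>{0..1 / real (Suc n)}. {x. norm (V t x) \<le> real n})" by (auto simp: A_def)
    moreover have "closed {x. norm (V t x) \<le> real n}" if "t \<in> {0..1 / real (Suc n)}" for t
    proof -
      have "continuous_on UNIV (\<lambda>x. V t x)"
        using that bl[of t] by (simp add: linear_continuous_on)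
      then show ?thesis by (intro closed_Collect_le continuous_on_norm continuous_on_const)
    qed
    ultimately show ?thesis by (metis (no_types, lifting) closed_INT)
  qed
  moreover have cover: "(\<Union>n. A n) = UNIV"
  proof -
    have "\<exists>n. x \<in> A n" for x
    proof -
      have "eventually (\<lambda>t. dist (V t x) x < 1) (at_right 0)"
        using tendstoD[OF right_cont] by simp
      then obtain b where b: "b > 0" "\<And>t. 0 < t \<Longrightarrow> t < b \<Longrightarrow> dist (V t x) x < 1"
        by (auto simp: eventually_at_right_field)
      obtain n1 where n1: "1 / real (Suc n1) < b" using b(1) nat_approx_posE by blast
      obtain n2 where n2: "norm x + 1 < real n2" using reals_Archimedean2 by blast
      define n where "n = max n1 n2"
      have nb: "1 / real (Suc n) < b"
        using n1 by (rule order_le_less_trans[rotated]) (auto simp: n_def intro!: divide_left_mono)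
      have "norm (V t x) \<le> real n" if t: "t \<in> {0..1 / real (Suc n)}" for t
      proof (cases "t = 0")
        case True
        then show ?thesis using n2 by (simp add: n_def)
      next
        case False
        then have "dist (V t x) x < 1" using b(2)[of t] t nb by auto
        then have "norm (V t x) < norm x + 1"
          using norm_triangle_sub[of "V t x" x] by (simp add: dist_norm)
        then show ?thesis using n2 by (simp add: n_def)
      qed
      then have "x \<in> A n" unfolding A_def by blast
      then show ?thesis ..
    qed
    then show ?thesis by auto
  qed
  ultimately have "\<exists>n. interior (A n) \<noteq> {}"
  proof -
    assume cl: "\<And>n. closed (A n)" and cover: "(\<Union>n. A n) = UNIV"
    show ?thesis
    proof (rule ccontr)
      assume "\<not> ?thesis"
      then have "euclidean interior_of \<Union>(range A) = {}"
        using cl by (intro Baire_category_alt) (auto simp: completely_metrizable_space_euclidean)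
      then show False using cover by simp
    qed
  qed
  then obtain n x0 r where r: "r > 0" "ball x0 r \<subseteq> A n"
    by (metis ex_in_conv mem_interior)
  have "norm (V t x) \<le> (4 * real n / r) * norm x" if t: "t \<in> {0..1 / real (Suc n)}" for t x
  proof (cases "x = 0")
    case True
    then show ?thesis using bl[of t] t by (simp add: linear_simps bounded_linear.linear)
  next
    case False
    interpret bounded_linear "V t" using bl t by simp
    \<comment> \<open>With norm \<open>r / 2\<close>, both \<open>x0\<close> and
      \<open>x0 + y\<close> lie in the ball; their difference costs \<open>2 * n\<close>, and
      undoing the scaling produces \<open>4 * n / r\<close>.\<close>
    define y where "y = (r / (2 * norm x)) *\<^sub>R x"
    have "norm y = r / 2" using False r(1) by (simp add: y_def)
    then have "x0 + y \<in> ball x0 r" "x0 \<in> ball x0 r" using r(1) by (auto simp: dist_norm)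
    then have "norm (V t (x0 + y)) \<le> n" "norm (V t x0) \<le> n" using r(2) t unfolding A_def by blast+
    then have "norm (V t y) \<le> 2 * n"
      using norm_triangle_ineq4[of "V t (x0 + y)" "V t x0"] by (simp add: local.add)
    moreover have "norm (V t y) = r / (2 * norm x) * norm (V t x)"
      using r(1) by (simp add: y_def scale)
    ultimately show ?thesis using r(1) False by (simp add: field_simps)
  qed
  then show ?thesis by (intro exI[of _ "1 / real (Suc n)"] conjI exI[of _ "4 * real n / r"]) auto
qed

text \<open>The semigroup law iterates the bound on \<open>{0..\<delta>}\<close> over enough steps
  of length \<delta> to reach \<open>t0\<close>.\<close>

lemma locally_bounded:
  "\<exists>K\<ge>0. \<forall>t\<in>{0..t0}. \<forall>x. norm (V t x) \<le> K * norm x"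
proof -
  obtain \<delta> M where \<delta>: "\<delta> > 0" and M0: "\<And>t x. t \<in> {0..\<delta>} \<Longrightarrow> norm (V t x) \<le> M * norm x"
    using bounded_near_zero by blast
  \<comment> \<open>A constant of at least 1 has increasing powers, so times reached in a single
    step also obey the bound with the larger power.\<close>
  define M' where "M' = max 1 M"
  have M: "norm (V t x) \<le> M' * norm x" if "t \<in> {0..\<delta>}" for t x
    using M0[OF that, of x] mult_right_mono[of M M' "norm x"] by (simp add: M'_def)
  have M1: "1 \<le> M'" by (simp add: M'_def)
  have *: "norm (V t x) \<le> M' ^ n * norm x" if "t \<in> {0..real n * \<delta>}" for n t x
    using that
  proof (induction n arbitrary: t)
    case (Suc n)
    show ?case
    proof (cases "t \<le> \<delta>")
      case True
      have "M' * norm x \<le> M' ^ Suc n * norm x"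
        using M1 one_le_power[OF M1, of n] by (intro mult_right_mono) auto
      then show ?thesis using M[of t x] Suc True by (auto intro: order_trans)
    next
      case False
      then have "V t x = V \<delta> (V (t - \<delta>) x)" using add[of \<delta> "t - \<delta>" x] \<delta> by simp
      also have "norm \<dots> \<le> M' * norm (V (t - \<delta>) x)" using \<delta> by (intro M) auto
      also have "\<dots> \<le> M' * (M' ^ n * norm x)"
        using Suc False M1 by (intro mult_left_mono) (auto simp: algebra_simps)
      finally show ?thesis by (simp add: mult.assoc)
    qed
  qed simp
  obtain n where "t0 / \<delta> < real n" using reals_Archimedean2 by blast
  then have "t0 \<le> real n * \<delta>" using \<delta> by (simp add: field_simps)
  then show ?thesis using M1 * by (intro exI[of _ "M' ^ n"]) auto
qed

section \<open>Continuity and differentiability of orbits\<close>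

lemma filterlim_abs_diff_at_right:
  "filterlim (\<lambda>s. \<bar>s - t\<bar>) (at_right 0) (at t within S)" for t :: real
  unfolding filterlim_at
proof
  show "eventually (\<lambda>s. \<bar>s - t\<bar> \<in> {0<..} \<and> \<bar>s - t\<bar> \<noteq> 0) (at t within S)"
    by (auto simp: eventually_at intro!: exI[of _ 1])
  have "((\<lambda>s. \<bar>s - t\<bar>) \<longlongrightarrow> \<bar>t - t\<bar>) (at t within S)" by (intro tendsto_intros)
  then show "((\<lambda>s. \<bar>s - t\<bar>) \<longlongrightarrow> 0) (at t within S)" by simp
qed

lemma eventually_nonneg_le:
  "eventually (\<lambda>s. s \<noteq> t \<and> s \<in> {0..t + 1}) (at t within {0..})" for t :: real
  by (auto simp: eventually_at dist_real_def intro!: exI[of _ 1])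

text \<open>With \<open>m = min s t\<close>, the increment is up to sign \<open>V m\<close> applied
  to \<open>V \<bar>s - t\<bar> x - x\<close>. The local bound on \<open>V m\<close> and right
  continuity at 0 thus handle both sides of \<open>t\<close> at once.\<close>

lemma orbit_continuous: "continuous_on {0..} (\<lambda>t. V t x)"
  unfolding continuous_on_def
proof
  fix t :: real assume t: "t \<in> {0..}"
  obtain K where K: "\<And>s x. s \<in> {0..t+1} \<Longrightarrow> norm (V s x) \<le> K * norm x" using locally_bounded by blast
  have "((\<lambda>s. V \<bar>s - t\<bar> x - x) \<longlongrightarrow> x - x) (at t within {0..})"
    by (intro tendsto_diff tendsto_const filterlim_compose[OF right_cont filterlim_abs_diff_at_right])
  then have lim: "((\<lambda>s. K * norm (V \<bar>s - t\<bar> x - x)) \<longlongrightarrow> 0) (at t within {0..})"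
    by (intro tendsto_mult_right_zero tendsto_norm_zero) simp
  have "((\<lambda>s. V s x - V t x) \<longlongrightarrow> 0) (at t within {0..})"
  proof (rule Lim_null_comparison[OF _ lim])
    show "eventually (\<lambda>s. norm (V s x - V t x) \<le> K * norm (V \<bar>s - t\<bar> x - x)) (at t within {0..})"
      using eventually_nonneg_le
    proof eventually_elim
      case (elim s)
      define m where "m = min s t"
      have m: "m \<in> {0..t+1}" using elim t by (auto simp: m_def)
      interpret bounded_linear "V m" using bl m by simp
      have "V (max s t) x = V m (V \<bar>s - t\<bar> x)"
        using local.c0_semigroup_axioms c0_semigroup.add[of V m "\<bar>s - t\<bar>" x] m
        by (auto simp: m_def min_def max_def split: if_splits)
      then have "norm (V s x - V t x) = norm (V m (V \<bar>s - t\<bar> x) - V m x)"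
        by (auto simp: m_def norm_minus_commute min_def max_def split: if_splits)
      then have "norm (V s x - V t x) = norm (V m (V \<bar>s - t\<bar> x - x))" by (simp add: diff)
      then show ?case using K[OF m] by simp
    qed
  qed
  then show "((\<lambda>s. V s x) \<longlongrightarrow> V t x) (at t within {0..})" by (simp add: LIM_zero_cancel)
qed

text \<open>On either side of \<open>t\<close> the difference quotient is
  \<open>V m (q \<bar>s - t\<bar>)\<close> with \<open>m = min s t\<close>. For \<open>s < t\<close>
  the base point is \<open>s\<close> instead of \<open>t\<close>; continuity of the orbit of
  \<open>y\<close> absorbs this.\<close>

lemma orbit_has_vector_derivative:
  assumes y: "((\<lambda>h. (1 / h) *\<^sub>R (V h x - x)) \<longlongrightarrow> y) (at_right 0)" and t: "0 \<le> t"
  shows "((\<lambda>t. V t x) has_vector_derivative V t y) (at t within {0..})"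
proof -
  obtain K where K: "\<And>s x. s \<in> {0..t+1} \<Longrightarrow> norm (V s x) \<le> K * norm x" using locally_bounded by blast
  define q where "q h = (1 / h) *\<^sub>R (V h x - x)" for h
  have "((\<lambda>s. q \<bar>s - t\<bar> - y) \<longlongrightarrow> y - y) (at t within {0..})"
    using y unfolding q_def[symmetric]
    by (intro tendsto_diff tendsto_const filterlim_compose[OF _ filterlim_abs_diff_at_right])
  then have lim1: "((\<lambda>s. K * norm (q \<bar>s - t\<bar> - y)) \<longlongrightarrow> 0) (at t within {0..})"
    by (intro tendsto_mult_right_zero tendsto_norm_zero) simp
  have "((\<lambda>s. V s y) \<longlongrightarrow> V t y) (at t within {0..})"
    using orbit_continuous[of y] t by (simp add: continuous_on_def)
  then have "((\<lambda>s. norm (V s y - V t y)) \<longlongrightarrow> 0) (at t within {0..})"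
    by (intro tendsto_norm_zero LIM_zero)
  from tendsto_add[OF lim1 this]
  have lim: "((\<lambda>s. K * norm (q \<bar>s - t\<bar> - y) + norm (V s y - V t y)) \<longlongrightarrow> 0) (at t within {0..})" by simp
  have "((\<lambda>s. (1 / (s - t)) *\<^sub>R (V s x - V t x) - V t y) \<longlongrightarrow> 0) (at t within {0..})"
  proof (rule Lim_null_comparison[OF _ lim])
    show "eventually (\<lambda>s. norm ((1 / (s - t)) *\<^sub>R (V s x - V t x) - V t y)
        \<le> K * norm (q \<bar>s - t\<bar> - y) + norm (V s y - V t y)) (at t within {0..})"
      using eventually_nonneg_le
    proof eventually_elim
      case (elim s)
      define m where "m = min s t"
      have m: "m \<in> {0..t+1}" using elim t by (auto simp: m_def)
      interpret bounded_linear "V m" using bl m by simp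
      have quotient_flip: "(1 / (s - t)) *\<^sub>R (a - b) = (1 / (t - s)) *\<^sub>R (b - a)" for a b :: 'b
      proof -
        have "1 / (s - t) = - (1 / (t - s))" using minus_divide_right[of 1 "t - s"] by simp
        then show ?thesis by (simp only: scaleR_minus_left) (simp add: scaleR_diff_right)
      qed
      have "V (max s t) x = V m (V \<bar>s - t\<bar> x)"
        using local.c0_semigroup_axioms c0_semigroup.add[of V m "\<bar>s - t\<bar>" x] m
        by (auto simp: m_def min_def max_def split: if_splits)
      then have "(1 / (s - t)) *\<^sub>R (V s x - V t x) = (1 / \<bar>s - t\<bar>) *\<^sub>R (V m (V \<bar>s - t\<bar> x) - V m x)"
      proof (cases "s < t")
        assume V: "V (max s t) x = V m (V \<bar>s - t\<bar> x)"
        case True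
        then show ?thesis using V quotient_flip[of "V s x" "V t x"] by (simp add: m_def)
      next
        assume "V (max s t) x = V m (V \<bar>s - t\<bar> x)"
        moreover case False
        ultimately show ?thesis by (simp add: m_def)
      qed
      also have "\<dots> = V m (q \<bar>s - t\<bar> - y) + V m y" by (simp add: q_def diff scale)
      finally have "norm ((1 / (s - t)) *\<^sub>R (V s x - V t x) - V t y)
          \<le> norm (V m (q \<bar>s - t\<bar> - y)) + norm (V m y - V t y)"
        by (metis add_diff_eq norm_triangle_ineq)
      moreover have "norm (V m y - V t y) \<le> norm (V s y - V t y)" by (auto simp: m_def min_def)
      ultimately show ?case using K[OF m, of "q \<bar>s - t\<bar> - y"] by linarith
    qed
  qed
  then show ?thesis
    unfolding has_vector_derivative_def has_derivative_iff_norm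
  proof (intro conjI bounded_linear_scaleR_left)
    assume "((\<lambda>s. (1 / (s - t)) *\<^sub>R (V s x - V t x) - V t y) \<longlongrightarrow> 0) (at t within {0..})"
    then have "((\<lambda>s. norm ((1 / (s - t)) *\<^sub>R (V s x - V t x) - V t y)) \<longlongrightarrow> 0) (at t within {0..})"
      by (rule tendsto_norm_zero)
    then show "((\<lambda>s. norm (V s x - V t x - (s - t) *\<^sub>R V t y) / norm (s - t)) \<longlongrightarrow> 0) (at t within {0..})"
    proof (rule Lim_transform_eventually)
      show "eventually (\<lambda>s. norm ((1 / (s - t)) *\<^sub>R (V s x - V t x) - V t y)
          = norm (V s x - V t x - (s - t) *\<^sub>R V t y) / norm (s - t)) (at t within {0..})"
        using eventually_nonneg_le
      proof eventually_elim
        case (elim s)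
        have "V s x - V t x - (s - t) *\<^sub>R V t y = (s - t) *\<^sub>R ((1 / (s - t)) *\<^sub>R (V s x - V t x) - V t y)"
          using elim by (simp add: scaleR_diff_right)
        then show ?case using elim by (simp only: norm_scaleR) simp
      qed
    qed
  qed
qed

end

section \<open>Transport of an abstract semigroup to a Banach space\<close>

text \<open>\<open>J\<close> identifies the abstract normed space \<open>(X, N)\<close> with a complete type class instance,
  on which Baire's theorem is available.\<close>

locale c0_semigroup_in_coordinates =
  fixes X :: "'c::real_vector set" and N :: "'c \<Rightarrow> real" and T :: "real \<Rightarrow> 'c \<Rightarrow> 'c"
    and D :: "'c set" and G :: "'c \<Rightarrow> 'c"
    and J :: "'c \<Rightarrow> 'b::{real_normed_vector, complete_space}" and I :: "'b \<Rightarrow> 'c"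
    and k1 k2 :: real
  assumes gen: "C0_semigroup_gen X N T D G"
    and J_add: "x \<in> X \<Longrightarrow> y \<in> X \<Longrightarrow> J (x + y) = J x + J y"
    and J_scale: "x \<in> X \<Longrightarrow> J (r *\<^sub>R x) = r *\<^sub>R J x"
    and I_in: "I z \<in> X" and JI [simp]: "J (I z) = z" and IJ: "x \<in> X \<Longrightarrow> I (J x) = x"
    and k1: "0 < k1" and lower: "x \<in> X \<Longrightarrow> k1 * norm (J x) \<le> N x"
    and k2: "0 < k2" and upper: "x \<in> X \<Longrightarrow> N x \<le> k2 * norm (J x)"
begin

lemma
  shows T_in: "0 \<le> t \<Longrightarrow> x \<in> X \<Longrightarrow> T t x \<in> X"
    and T_lin: "0 \<le> t \<Longrightarrow> lin_op X (T t)"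
    and T_bound: "0 \<le> t \<Longrightarrow> \<exists>M. \<forall>x\<in>X. N (T t x) \<le> M * N x"
    and T_zero: "x \<in> X \<Longrightarrow> T 0 x = x"
    and T_add: "0 \<le> s \<Longrightarrow> 0 \<le> t \<Longrightarrow> x \<in> X \<Longrightarrow> T (s + t) x = T s (T t x)"
    and T_cont: "x \<in> X \<Longrightarrow> ((\<lambda>t. N (T t x - x)) \<longlongrightarrow> 0) (at_right 0)"
    and D_sub: "D \<subseteq> X"
    and D_char: "x \<in> X \<Longrightarrow> y \<in> X \<Longrightarrow>
        ((\<lambda>h. N ((1 / h) *\<^sub>R (T h x - x) - y)) \<longlongrightarrow> 0) (at_right 0) \<Longrightarrow> x \<in> D"
    and G_in: "x \<in> D \<Longrightarrow> G x \<in> X"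
    and G_lim: "x \<in> D \<Longrightarrow> ((\<lambda>h. N ((1 / h) *\<^sub>R (T h x - x) - G x)) \<longlongrightarrow> 0) (at_right 0)"
  using gen unfolding C0_semigroup_gen_def by blast+

lemma sub: "subspace X"
  using T_lin[of 0] by (simp add: lin_op_def)

lemma J_diff: "x \<in> X \<Longrightarrow> y \<in> X \<Longrightarrow> J (x - y) = J x - J y"
  using J_add[of x "(-1) *\<^sub>R y"] J_scale[of y "-1"] subspace_scale[OF sub, of y "-1"] by simp

lemma I_add: "I (y + z) = I y + I z"
  using IJ[of "I y + I z"] J_add[OF I_in I_in] subspace_add[OF sub I_in I_in] by simp

lemma I_scale: "I (r *\<^sub>R y) = r *\<^sub>R I y"
  using IJ[of "r *\<^sub>R I y"] J_scale[OF I_in] subspace_scale[OF sub I_in] by simp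

definition V where "V t z = J (T t (I z))"

lemma V_J: "x \<in> X \<Longrightarrow> V t (J x) = J (T t x)"
  by (simp add: V_def IJ)

lemma tendsto_J_iff:
  assumes "eventually (\<lambda>h. f h \<in> X) F"
  shows "((\<lambda>h. N (f h)) \<longlongrightarrow> 0) F \<longleftrightarrow> ((\<lambda>h. J (f h)) \<longlongrightarrow> 0) F"
proof
  assume "((\<lambda>h. N (f h)) \<longlongrightarrow> 0) F"
  from tendsto_mult_right_zero[OF this, of "1 / k1"]
  have "((\<lambda>h. 1 / k1 * N (f h)) \<longlongrightarrow> 0) F" .
  then show "((\<lambda>h. J (f h)) \<longlongrightarrow> 0) F"
  proof (rule Lim_null_comparison[rotated])
    show "eventually (\<lambda>h. norm (J (f h)) \<le> 1 / k1 * N (f h)) F"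
      using assms by eventually_elim (use lower k1 in \<open>simp add: field_simps\<close>)
  qed
next
  assume "((\<lambda>h. J (f h)) \<longlongrightarrow> 0) F"
  then have "((\<lambda>h. k2 * norm (J (f h))) \<longlongrightarrow> 0) F"
    by (intro tendsto_mult_right_zero tendsto_norm_zero)
  then show "((\<lambda>h. N (f h)) \<longlongrightarrow> 0) F"
  proof (rule Lim_null_comparison[rotated])
    show "eventually (\<lambda>h. norm (N (f h)) \<le> k2 * norm (J (f h))) F"
      using assms
    proof eventually_elim
      case (elim h)
      have "0 \<le> k1 * norm (J (f h))" using k1 by simp
      then show ?case using lower[OF elim] upper[OF elim] by simp
    qed
  qed
qed

sublocale V: c0_semigroup V
proof (rule c0_semigroup.intro)
  fix t :: real assume t: "0 \<le> t"
  obtain M where M: "\<And>x. x \<in> X \<Longrightarrow> N (T t x) \<le> M * N x" using T_bound[OF t] by blast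
  have Tadd: "T t (x + y) = T t x + T t y" and Tscale: "T t (r *\<^sub>R x) = r *\<^sub>R T t x"
    if "x \<in> X" "y \<in> X" for x y r using T_lin[OF t] that by (auto simp: lin_op_def)
  show "bounded_linear (V t)"
  proof (rule bounded_linear_intro[of _ "\<bar>M\<bar> * k2 / k1"])
    show "V t (x + y) = V t x + V t y" for x y
      by (simp add: V_def I_add I_in Tadd J_add T_in t)
    show "V t (r *\<^sub>R x) = r *\<^sub>R V t x" for r x
      using Tscale[OF I_in I_in] by (simp add: V_def I_scale I_in J_scale T_in t)
    show "norm (V t x) \<le> norm x * (\<bar>M\<bar> * k2 / k1)" for x
    proof -
      have N0: "0 \<le> N (I x)" using lower[OF I_in, of x] k1
        by (simp add: order_trans[OF _ lower[OF I_in, of x]])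
      have "k1 * norm (V t x) \<le> N (T t (I x))"
        unfolding V_def by (intro lower T_in t I_in)
      also have "\<dots> \<le> M * N (I x)" by (intro M I_in)
      also have "\<dots> \<le> \<bar>M\<bar> * N (I x)" by (intro mult_right_mono N0) auto
      also have "\<dots> \<le> \<bar>M\<bar> * (k2 * norm x)"
        using upper[OF I_in, of x] by (intro mult_left_mono) auto
      finally show ?thesis using k1 by (simp add: field_simps)
    qed
  qed
next
  show "V 0 x = x" for x by (simp add: V_def T_zero I_in)
next
  show "V (s + t) x = V s (V t x)" if "0 \<le> s" "0 \<le> t" for s t x
    using that by (simp add: V_def T_add I_in IJ T_in)
next
  fix x :: 'b
  have ev: "eventually (\<lambda>t. t > (0::real)) (at_right 0)" by (rule eventually_at_right_less)
  have "((\<lambda>t. J (T t (I x) - I x)) \<longlongrightarrow> 0) (at_right 0)"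
  proof (subst tendsto_J_iff[symmetric])
    show "eventually (\<lambda>h. T h (I x) - I x \<in> X) (at_right 0)"
      using ev by eventually_elim (auto intro!: subspace_diff[OF sub] T_in I_in)
  qed (rule T_cont[OF I_in])
  then have "((\<lambda>t. V t x - x) \<longlongrightarrow> 0) (at_right 0)"
    by (rule Lim_transform_eventually)
      (use ev in eventually_elim, simp add: V_def J_diff T_in I_in)
  then show "((\<lambda>t. V t x) \<longlongrightarrow> x) (at_right 0)" by (rule LIM_zero_cancel)
qed

lemma quotient_lim_iff:
  assumes x: "x \<in> X" and y: "y \<in> X"
  shows "((\<lambda>h. N ((1 / h) *\<^sub>R (T h x - x) - y)) \<longlongrightarrow> 0) (at_right 0) \<longleftrightarrow>
    ((\<lambda>h. (1 / h) *\<^sub>R (V h (J x) - J x)) \<longlongrightarrow> J y) (at_right 0)"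
proof -
  have ev: "eventually (\<lambda>t. t > (0::real)) (at_right 0)" by (rule eventually_at_right_less)
  have "((\<lambda>h. N ((1 / h) *\<^sub>R (T h x - x) - y)) \<longlongrightarrow> 0) (at_right 0) \<longleftrightarrow>
    ((\<lambda>h. J ((1 / h) *\<^sub>R (T h x - x) - y)) \<longlongrightarrow> 0) (at_right 0)"
    by (rule tendsto_J_iff, use ev in eventually_elim)
      (auto intro!: subspace_diff[OF sub] subspace_scale[OF sub] T_in x y)
  also have "\<dots> \<longleftrightarrow> ((\<lambda>h. (1 / h) *\<^sub>R (V h (J x) - J x) - J y) \<longlongrightarrow> 0) (at_right 0)"
    by (rule tendsto_cong, use ev in eventually_elim)
      (simp add: V_J x y J_diff J_scale T_in subspace_diff[OF sub] subspace_scale[OF sub])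
  also have "\<dots> \<longleftrightarrow> ((\<lambda>h. (1 / h) *\<^sub>R (V h (J x) - J x)) \<longlongrightarrow> J y) (at_right 0)"
    by (rule LIM_zero_iff)
  finally show ?thesis .
qed

lemma generator_lim:
  "x \<in> D \<Longrightarrow> ((\<lambda>h. (1 / h) *\<^sub>R (V h (J x) - J x)) \<longlongrightarrow> J (G x)) (at_right 0)"
  using quotient_lim_iff G_lim G_in D_sub by blast

text \<open>The bounded operator \<open>V t\<close> commutes with \<open>V h\<close>, so it maps the
  difference quotients at \<open>x\<close> to those at \<open>T t x\<close> and preserves their
  limit. Existence of that limit is membership in \<open>D\<close>; its uniqueness gives the
  commutation with \<open>G\<close>.\<close>

lemma
  assumes x: "x \<in> D" and t: "0 \<le> t"
  shows T_in_D: "T t x \<in> D" and G_T: "G (T t x) = T t (G x)"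
proof -
  have xX: "x \<in> X" using x D_sub by blast
  interpret bounded_linear "V t" using V.bl t by simp
  have "((\<lambda>h. V t ((1 / h) *\<^sub>R (V h (J x) - J x))) \<longlongrightarrow> V t (J (G x))) (at_right 0)"
    by (intro tendsto generator_lim x)
  then have lim: "((\<lambda>h. (1 / h) *\<^sub>R (V h (J (T t x)) - J (T t x))) \<longlongrightarrow> J (T t (G x))) (at_right 0)"
    unfolding V_J[OF G_in[OF x]]
  proof (rule Lim_transform_eventually)
    have "eventually (\<lambda>h. h > (0::real)) (at_right 0)" by (rule eventually_at_right_less)
    then show "eventually (\<lambda>h. V t ((1 / h) *\<^sub>R (V h (J x) - J x)) =
        (1 / h) *\<^sub>R (V h (J (T t x)) - J (T t x))) (at_right 0)"
    proof eventually_elim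
      case (elim h)
      have "V h (V t (J x)) = V t (V h (J x))"
        using V.add[of h t "J x"] V.add[of t h "J x"] elim t by (simp add: add.commute)
      then show ?case using V_J[OF xX, of t] by (simp only: scale diff)
    qed
  qed
  have TG: "T t (G x) \<in> X" and TX: "T t x \<in> X" using T_in t G_in[OF x] xX by auto
  show TD: "T t x \<in> D" using D_char[OF TX TG] quotient_lim_iff[OF TX TG] lim by blast
  have "J (G (T t x)) = J (T t (G x))"
    using tendsto_unique[OF _ generator_lim[OF TD] lim] by simp
  then show "G (T t x) = T t (G x)" using IJ[OF G_in[OF TD]] IJ[OF TG] by metis
qed

lemma J_orbit_has_vector_derivative:
  assumes "x \<in> D" and "0 \<le> t"
  shows "((\<lambda>t. J (T t x)) has_vector_derivative J (G (T t x))) (at t within {0..})"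
  using V.orbit_has_vector_derivative[OF generator_lim[OF assms(1)] assms(2)]
    V_J[OF G_in[OF assms(1)]] V_J[of x] G_T[OF assms] assms D_sub by (simp add: subset_iff)

lemma J_orbit_continuous: "x \<in> X \<Longrightarrow> continuous_on {0..} (\<lambda>t. J (T t x))"
  using V.orbit_continuous[of "J x"] by (simp add: V_J)

text \<open>The generator value is approximated by difference quotients, which stay in the domain;
  the flow of the approximants converges uniformly on compact time intervals.\<close>

lemma generator_value_approx:
  assumes x: "x \<in> D" "0 \<le> t0" and e: "0 < e"
  obtains w where "w \<in> D"
    "\<And>t. t \<in> {0..t0} \<Longrightarrow> norm (J (T t w) - J (T t (G x))) \<le> e"
proof -
  have xX: "x \<in> X" using x D_sub by blast
  have GX: "G x \<in> X" using G_in x by blast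
  obtain K where K: "K \<ge> 0" "\<And>t y. t \<in> {0..t0} \<Longrightarrow> norm (V t y) \<le> K * norm y"
    using V.locally_bounded by blast
  \<comment> \<open>The denominator \<open>K + 1\<close> also covers \<open>K = 0\<close> and still
    gives \<open>K * (e / (K + 1)) \<le> e\<close>.\<close>
  have "e / (K + 1) > 0" using e K(1) by simp
  then have "eventually (\<lambda>h. dist ((1 / h) *\<^sub>R (V h (J x) - J x)) (J (G x)) < e / (K + 1) \<and> h > 0) (at_right 0)"
    by (intro eventually_conj tendstoD[OF generator_lim[OF x(1)]] eventually_at_right_less)
  then obtain h where h: "h > 0" "norm ((1 / h) *\<^sub>R (V h (J x) - J x) - J (G x)) < e / (K + 1)"
    using eventually_happens[of _ "at_right (0::real)"] by (auto simp: dist_norm)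
  define w where "w = (1 / h) *\<^sub>R (T h x - x)"
  have wX: "w \<in> X" unfolding w_def
    using h(1) by (intro subspace_scale[OF sub] subspace_diff[OF sub] T_in xX) auto
  have Jw: "J w = (1 / h) *\<^sub>R (V h (J x) - J x)"
    using h(1) by (simp add: w_def J_scale J_diff V_J xX T_in subspace_diff[OF sub])
  have ThD: "T h x \<in> D" using T_in_D x(1) h(1) by simp
  \<comment> \<open>By linearity \<open>g\<close> is the candidate for the generator value at
    \<open>w\<close>; the limit of quotients below certifies \<open>w \<in> D\<close>.\<close>
  define g where "g = (1 / h) *\<^sub>R (G (T h x) - G x)"
  have gX: "g \<in> X" unfolding g_def
    by (intro subspace_scale[OF sub] subspace_diff[OF sub] G_in ThD x)
  have "((\<lambda>r. (1 / h) *\<^sub>R ((1 / r) *\<^sub>R (V r (J (T h x)) - J (T h x)) - (1 / r) *\<^sub>R (V r (J x) - J x)))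
      \<longlongrightarrow> (1 / h) *\<^sub>R (J (G (T h x)) - J (G x))) (at_right 0)"
    by (intro tendsto_intros generator_lim ThD x)
  also have "(1 / h) *\<^sub>R (J (G (T h x)) - J (G x)) = J g"
    by (simp add: g_def J_scale J_diff G_in ThD x subspace_diff[OF sub])
  finally have "((\<lambda>r. (1 / r) *\<^sub>R (V r (J w) - J w)) \<longlongrightarrow> J g) (at_right 0)"
  proof (rule Lim_transform_eventually)
    have "eventually (\<lambda>r. r > (0::real)) (at_right 0)" by (rule eventually_at_right_less)
    then show "eventually (\<lambda>r. (1 / h) *\<^sub>R ((1 / r) *\<^sub>R (V r (J (T h x)) - J (T h x))
        - (1 / r) *\<^sub>R (V r (J x) - J x)) = (1 / r) *\<^sub>R (V r (J w) - J w)) (at_right 0)"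
    proof eventually_elim
      case (elim r)
      interpret bounded_linear "V r" using V.bl elim by simp
      have Jw': "J w = (1 / h) *\<^sub>R (J (T h x) - J x)" unfolding Jw using V_J[OF xX] by simp
      show ?case unfolding Jw' scale diff by (simp add: algebra_simps)
    qed
  qed
  then have "w \<in> D" using D_char[OF wX gX] quotient_lim_iff[OF wX gX] by blast
  moreover have "norm (J (T t w) - J (T t (G x))) \<le> e" if t: "t \<in> {0..t0}" for t
  proof -
    interpret bounded_linear "V t" using V.bl t by simp
    have "norm (J (T t w) - J (T t (G x))) = norm (V t (J w - J (G x)))"
      by (simp add: diff V_J wX GX)
    also have "\<dots> \<le> K * norm (J w - J (G x))" by (rule K(2)[OF t])
    also have "\<dots> \<le> K * (e / (K + 1))"
      using h(2) K(1) by (intro mult_left_mono) (auto simp: Jw)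
    also have "\<dots> \<le> e" using e K(1) by (simp add: field_simps)
    finally show ?thesis .
  qed
  ultimately show ?thesis using that by blast
qed

end

section \<open>The energy space\<close>

locale coupled_system =
  fixes DA1 DA2 DS1 DS2 :: "'a::{real_inner, complete_space} set"
    and A1 A2 S1 S2 B :: "'a \<Rightarrow> 'a"
    and \<omega>1 \<omega>2 \<beta> \<alpha> c :: real
    and T :: "real \<Rightarrow> 'a st \<Rightarrow> 'a st"
  assumes A1_sa: "selfadjoint_op DA1 A1" and A2_sa: "selfadjoint_op DA2 A2"
    and \<omega>1_pos: "\<omega>1 > 0" and \<omega>2_pos: "\<omega>2 > 0"
    and A1_coer: "u \<in> DA1 \<Longrightarrow> \<omega>1 * (norm u)\<^sup>2 \<le> inner (A1 u) u"
    and A2_coer: "u \<in> DA2 \<Longrightarrow> \<omega>2 * (norm u)\<^sup>2 \<le> inner (A2 u) u"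
    and S1_sqrt: "is_sqrt_op DA1 A1 DS1 S1"
    and S2_sqrt: "is_sqrt_op DA2 A2 DS2 S2"
    and B_bl: "bounded_linear B"
    and B_sym: "inner (B u) v = inner u (B v)"
    and \<beta>_pos: "\<beta> > 0"
    and B_coer: "\<beta> * (norm u)\<^sup>2 \<le> inner (B u) u"
    and \<alpha>_nonzero: "\<alpha> \<noteq> 0" and \<alpha>_bound: "\<bar>\<alpha>\<bar> < sqrt (\<omega>1 * \<omega>2)"
    and T_gen: "C0_semigroup_gen (Hsp DS1 DS2) (hnorm S1 S2 \<alpha>) T
                  (opA_dom DA1 DS1 DA2 DS2) (opA A1 A2 B \<alpha>)"
    and c_pos: "c > 0"
    and dom_incl: "DA2 \<subseteq> DS1"
    and S1_A2: "u \<in> DA2 \<Longrightarrow> norm (S1 u) \<le> c * norm (A2 u)"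
begin

lemma
  shows S1_lin: "lin_op DS1 S1" and S1_sym: "x \<in> DS1 \<Longrightarrow> y \<in> DS1 \<Longrightarrow> inner (S1 x) y = inner x (S1 y)"
    and DA1_iff: "u \<in> DA1 \<longleftrightarrow> u \<in> DS1 \<and> S1 u \<in> DS1" and A1_eq: "u \<in> DA1 \<Longrightarrow> A1 u = S1 (S1 u)"
    and S2_lin: "lin_op DS2 S2" and S2_sym: "x \<in> DS2 \<Longrightarrow> y \<in> DS2 \<Longrightarrow> inner (S2 x) y = inner x (S2 y)"
    and DA2_iff: "u \<in> DA2 \<longleftrightarrow> u \<in> DS2 \<and> S2 u \<in> DS2" and A2_eq: "u \<in> DA2 \<Longrightarrow> A2 u = S2 (S2 u)"
  using S1_sqrt S2_sqrt by (auto simp: is_sqrt_op_def selfadjoint_op_def)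

lemma S1_form: "u \<in> DS1 \<Longrightarrow> \<omega>1 * (norm u)\<^sup>2 \<le> (norm (S1 u))\<^sup>2"
  using sqrt_op_coercive[OF S1_sqrt \<omega>1_pos A1_coer] .

lemma S2_form: "u \<in> DS2 \<Longrightarrow> \<omega>2 * (norm u)\<^sup>2 \<le> (norm (S2 u))\<^sup>2"
  using sqrt_op_coercive[OF S2_sqrt \<omega>2_pos A2_coer] .

lemma S1_below: "u \<in> DS1 \<Longrightarrow> sqrt \<omega>1 * norm u \<le> norm (S1 u)"
  using real_sqrt_le_mono[OF S1_form, of u] by (simp add: real_sqrt_mult)

lemma S2_below: "u \<in> DS2 \<Longrightarrow> sqrt \<omega>2 * norm u \<le> norm (S2 u)"
  using real_sqrt_le_mono[OF S2_form, of u] by (simp add: real_sqrt_mult)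

lemma A1_onto: "A1 ` DA1 = UNIV"
  using selfadjoint_coercive_surj[OF A1_sa \<omega>1_pos A1_coer] .

lemma A2_onto: "A2 ` DA2 = UNIV"
  using selfadjoint_coercive_surj[OF A2_sa \<omega>2_pos A2_coer] .

text \<open>Every vector is some \<open>A1 u = S1 (S1 u)\<close> with \<open>S1 u\<close> in
  \<open>DS1\<close>, so the root inherits surjectivity from \<open>A1\<close>.\<close>

lemma S1_onto: "S1 ` DS1 = UNIV"
  using A1_onto by (force simp: DA1_iff A1_eq image_def set_eq_iff)

lemma S2_onto: "S2 ` DS2 = UNIV"
  using A2_onto by (force simp: DA2_iff A2_eq image_def set_eq_iff)

definition "I1 = inv_into DS1 S1"
definition "I2 = inv_into DS2 S2"
definition "R w = S1 (inv_into DA2 A2 w)"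

lemma I1: "bounded_linear I1" "x \<in> DS1 \<Longrightarrow> I1 (S1 x) = x" "I1 y \<in> DS1" "S1 (I1 y) = y"
  unfolding I1_def
  using bounded_linear_inv_into[OF S1_lin S1_onto _ S1_below] inv_into_coercive[OF S1_lin S1_onto _ S1_below]
    \<omega>1_pos S1_onto inv_into_into[of y S1 DS1] f_inv_into_f[of y S1 DS1] by auto

lemma I2: "bounded_linear I2" "x \<in> DS2 \<Longrightarrow> I2 (S2 x) = x" "I2 y \<in> DS2" "S2 (I2 y) = y"
  unfolding I2_def
  using bounded_linear_inv_into[OF S2_lin S2_onto _ S2_below] inv_into_coercive[OF S2_lin S2_onto _ S2_below]
    \<omega>2_pos S2_onto inv_into_into[of y S2 DS2] f_inv_into_f[of y S2 DS2] by auto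

lemma
  shows R_A2: "x \<in> DA2 \<Longrightarrow> R (A2 x) = S1 x" and R_bound: "norm (R w) \<le> c * norm w"
    and R_bl: "bounded_linear R"
proof -
  have lin: "lin_op DA2 A2" using A2_sa by (simp add: selfadjoint_op_def)
  have below: "\<omega>2 * norm x \<le> norm (A2 x)" if "x \<in> DA2" for x
  proof (cases "x = 0")
    case False
    have "\<omega>2 * norm x * norm x \<le> norm (A2 x) * norm x"
      using A2_coer[OF that] norm_cauchy_schwarz[of "A2 x" x] by (simp add: power2_eq_square)
    then show ?thesis using False by simp
  qed auto
  have bl: "bounded_linear (inv_into DA2 A2)" and inv: "\<And>x. x \<in> DA2 \<Longrightarrow> inv_into DA2 A2 (A2 x) = x"
    using bounded_linear_inv_into[OF lin A2_onto \<omega>2_pos below]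
      inv_into_coercive[OF lin A2_onto \<omega>2_pos below] by auto
  have inD: "inv_into DA2 A2 w \<in> DA2" and val: "A2 (inv_into DA2 A2 w) = w" for w
    using A2_onto inv_into_into[of w A2 DA2] f_inv_into_f[of w A2 DA2] by auto
  show "x \<in> DA2 \<Longrightarrow> R (A2 x) = S1 x" by (simp add: R_def inv)
  show bound: "norm (R w) \<le> c * norm w" for w
    using S1_A2[OF inD[of w]] val[of w] by (simp add: R_def)
  show "bounded_linear R"
  proof (rule bounded_linear_intro[of _ c])
    interpret bounded_linear "inv_into DA2 A2" by (rule bl)
    have inS: "inv_into DA2 A2 w \<in> DS1" for w using inD dom_incl by blast
    show "R (x + y) = R x + R y" for x y
      using S1_lin inS by (simp add: R_def add lin_op_def)
    show "R (r *\<^sub>R x) = r *\<^sub>R R x" for r x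
      using S1_lin inS by (simp add: R_def scale lin_op_def)
    show "norm (R x) \<le> norm x * c" for x using bound[of x] by (simp add: mult.commute)
  qed
qed

text \<open>The margin left by the strict bound on \<alpha>; it is the fraction of the uncoupled
  energy that survives the coupling term.\<close>

definition "\<kappa> = 1 - \<bar>\<alpha>\<bar> / sqrt (\<omega>1 * \<omega>2)"

lemma \<kappa>_pos: "0 < \<kappa>" and \<kappa>_le_1: "\<kappa> \<le> 1"
proof -
  have "0 < sqrt (\<omega>1 * \<omega>2)" using \<omega>1_pos \<omega>2_pos by simp
  then show "0 < \<kappa>" "\<kappa> \<le> 1" using \<alpha>_bound unfolding \<kappa>_def by auto
qed

text \<open>The lower bounds on \<open>S1\<close> and \<open>S2\<close> combine with
  \<open>2xy \<le> x^2 + y^2\<close>; the factor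
  \<open>\<bar>\<alpha>\<bar> / sqrt (\<omega>1 * \<omega>2)\<close> that results is
  \<open>1 - \<kappa>\<close>.\<close>

lemma coupling_bound:
  assumes u: "u \<in> DS1" and v: "v \<in> DS2"
  shows "2 * \<bar>\<alpha> * inner u v\<bar> \<le> (1 - \<kappa>) * ((norm (S1 u))\<^sup>2 + (norm (S2 v))\<^sup>2)"
proof -
  define w where "w = sqrt (\<omega>1 * \<omega>2)"
  have w: "w > 0" "w = sqrt \<omega>1 * sqrt \<omega>2" using \<omega>1_pos \<omega>2_pos by (simp_all add: w_def real_sqrt_mult)
  have "w * \<bar>inner u v\<bar> \<le> w * (norm u * norm v)"
    using w(1) by (intro mult_left_mono Cauchy_Schwarz_ineq2) auto
  also have "\<dots> = (sqrt \<omega>1 * norm u) * (sqrt \<omega>2 * norm v)" by (simp add: w(2))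
  also have "\<dots> \<le> norm (S1 u) * norm (S2 v)"
    using \<omega>1_pos \<omega>2_pos by (intro mult_mono S1_below S2_below u v) auto
  finally have "2 * (w * \<bar>inner u v\<bar>) \<le> (norm (S1 u))\<^sup>2 + (norm (S2 v))\<^sup>2"
    using sum_squares_bound[of "norm (S1 u)" "norm (S2 v)"] by linarith
  then have "\<bar>\<alpha>\<bar> / w * (2 * (w * \<bar>inner u v\<bar>)) \<le> \<bar>\<alpha>\<bar> / w * ((norm (S1 u))\<^sup>2 + (norm (S2 v))\<^sup>2)"
    using w(1) by (intro mult_left_mono) auto
  then show ?thesis using w(1) by (simp add: \<kappa>_def w_def[symmetric] abs_mult)
qed

text \<open>Maps the energy space bijectively onto the full product of four copies of the Hilbert
  space, whose product norm is complete and corresponds to the energy without coupling.\<close>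

fun J :: "'a st \<Rightarrow> 'a st" where
  "J (u, p, v, q) = (S1 u, p, S2 v, q)"

fun Ji :: "'a st \<Rightarrow> 'a st" where
  "Ji (a, p, b, q) = (I1 a, p, I2 b, q)"

lemma norm_J: "(norm (J (u, p, v, q)))\<^sup>2 = (norm (S1 u))\<^sup>2 + (norm p)\<^sup>2 + (norm (S2 v))\<^sup>2 + (norm q)\<^sup>2"
  by (simp add: norm_Pair)

abbreviation "E \<equiv> energy S1 S2 \<alpha>"

lemma energy_eq:
  "2 * E (u, p, v, q) =
    (norm (S1 u))\<^sup>2 + (norm p)\<^sup>2 + (norm (S2 v))\<^sup>2 + (norm q)\<^sup>2 + 2 * \<alpha> * inner u v"
  by (simp add: energy_def hinner_def power2_norm_eq_inner inner_commute)

text \<open>The coupling costs at most the share \<open>1 - \<kappa>\<close> of the two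
  \<open>S\<close> terms; the velocity terms are reduced to the same factor using
  \<open>\<kappa> \<le> 1\<close>.\<close>

lemma energy_lower: "U \<in> Hsp DS1 DS2 \<Longrightarrow> \<kappa> * (norm (J U))\<^sup>2 \<le> 2 * E U"
proof (cases U)
  case (fields u p v q)
  moreover assume "U \<in> Hsp DS1 DS2"
  ultimately have "u \<in> DS1" "v \<in> DS2" by (auto simp: Hsp_def)
  from coupling_bound[OF this] show ?thesis
    using mult_right_mono[OF \<kappa>_le_1, of "(norm p)\<^sup>2 + (norm q)\<^sup>2"]
    unfolding fields norm_J energy_eq by (simp add: algebra_simps)
qed

lemma energy_upper: "U \<in> Hsp DS1 DS2 \<Longrightarrow> E U \<le> (norm (J U))\<^sup>2"
proof (cases U)
  case (fields u p v q)
  moreover assume "U \<in> Hsp DS1 DS2"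
  ultimately have "u \<in> DS1" "v \<in> DS2" by (auto simp: Hsp_def)
  from coupling_bound[OF this]
  have "2 * \<bar>\<alpha> * inner u v\<bar> \<le> (norm (S1 u))\<^sup>2 + (norm (S2 v))\<^sup>2"
    using \<kappa>_pos mult_right_mono[of "1 - \<kappa>" 1 "(norm (S1 u))\<^sup>2 + (norm (S2 v))\<^sup>2"] by simp
  moreover have dominated: "a + b + d + e + 2 * z \<le> 2 * (a + b + d + e)"
    if "2 * \<bar>z\<bar> \<le> a + d" "0 \<le> b" "0 \<le> e" for a b d e z :: real
    using that by argo
  ultimately have "2 * E U \<le> 2 * (norm (J U))\<^sup>2"
    unfolding fields norm_J energy_eq mult.assoc[of 2 \<alpha>]
    by (intro dominated) auto
  then show ?thesis by simp
qed

lemma energy_nonneg: "U \<in> Hsp DS1 DS2 \<Longrightarrow> 0 \<le> E U"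
  using energy_lower[of U] \<kappa>_pos by (smt (verit, best) mult_nonneg_nonneg zero_le_power2)

lemma hnorm_eq: "hnorm S1 S2 \<alpha> U = sqrt (2 * E U)"
  by (simp add: hnorm_def energy_def)

text \<open>Since the norm is \<open>sqrt (2 * E U)\<close>, the two energy bounds give norm
  equivalence with constants \<open>sqrt \<kappa>\<close> and \<open>sqrt 2\<close>.\<close>

sublocale c0_semigroup_in_coordinates "Hsp DS1 DS2" "hnorm S1 S2 \<alpha>" T
  "opA_dom DA1 DS1 DA2 DS2" "opA A1 A2 B \<alpha>" J Ji "sqrt \<kappa>" "sqrt 2"
proof (rule c0_semigroup_in_coordinates.intro)
  show "J (x + y) = J x + J y" if "x \<in> Hsp DS1 DS2" "y \<in> Hsp DS1 DS2" for x y
    using that S1_lin S2_lin by (cases x; cases y) (auto simp: Hsp_def lin_op_def)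
  show "J (r *\<^sub>R x) = r *\<^sub>R J x" if "x \<in> Hsp DS1 DS2" for r x
    using that S1_lin S2_lin by (cases x) (auto simp: Hsp_def lin_op_def)
  show "Ji z \<in> Hsp DS1 DS2" "J (Ji z) = z" for z
    by (cases z; simp add: Hsp_def I1 I2)+
  show "Ji (J x) = x" if "x \<in> Hsp DS1 DS2" for x
    using that by (cases x) (auto simp: Hsp_def I1 I2)
  show "sqrt \<kappa> * norm (J x) \<le> hnorm S1 S2 \<alpha> x" if "x \<in> Hsp DS1 DS2" for x
    using real_sqrt_le_mono[OF energy_lower[OF that]] by (simp add: hnorm_eq real_sqrt_mult)
  show "hnorm S1 S2 \<alpha> x \<le> sqrt 2 * norm (J x)" if "x \<in> Hsp DS1 DS2" for x
    using real_sqrt_le_mono[OF energy_upper[OF that]] by (simp add: hnorm_eq real_sqrt_mult)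
qed (use T_gen \<kappa>_pos in auto)

end

section \<open>Dissipation\<close>

text \<open>Stated for six independent curves: \<open>a\<close> and \<open>b\<close> stand for
  \<open>S1 u\<close> and \<open>S2 v\<close>, whose derivatives are supplied separately from those
  of \<open>u\<close> and \<open>v\<close>.\<close>

lemma energy_functional_has_derivative:
  fixes a p b q u v :: "real \<Rightarrow> 'a::real_inner"
  assumes "(a has_vector_derivative a') (at t within X)" "(p has_vector_derivative p') (at t within X)"
    "(b has_vector_derivative b') (at t within X)" "(q has_vector_derivative q') (at t within X)"
    "(u has_vector_derivative u') (at t within X)" "(v has_vector_derivative v') (at t within X)"
  shows "((\<lambda>s. (inner (a s) (a s) + inner (p s) (p s) + inner (b s) (b s) + inner (q s) (q s)
      + 2 * (k * inner (u s) (v s))) / 2) has_real_derivative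
    inner (a t) a' + inner (p t) p' + inner (b t) b' + inner (q t) q' + k * inner u' (v t) + k * inner (u t) v')
    (at t within X)"
  using assms unfolding has_vector_derivative_def has_field_derivative_def
  by (auto intro!: derivative_eq_intros simp: fun_eq_iff inner_commute algebra_simps)

lemma norm_fst_snd_le: "norm (fst (snd z)) \<le> norm z"
  using norm_fst_le[of "fst (snd z)" "snd (snd z)"] norm_snd_le[of "snd z" "fst z"]
  unfolding prod.collapse by (rule order_trans)

context coupled_system
begin

abbreviation "\<D> \<equiv> opA_dom DA1 DS1 DA2 DS2"
abbreviation "\<A> \<equiv> opA A1 A2 B \<alpha>"

lemma
  shows DS1_subspace: "subspace DS1" and DS2_subspace: "subspace DS2"
    and S1_scale: "x \<in> DS1 \<Longrightarrow> S1 (r *\<^sub>R x) = r *\<^sub>R S1 x"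
    and S2_scale: "x \<in> DS2 \<Longrightarrow> S2 (r *\<^sub>R x) = r *\<^sub>R S2 x"
  using S1_lin S2_lin by (auto simp: lin_op_def)

lemma
  shows S1_diff: "x \<in> DS1 \<Longrightarrow> y \<in> DS1 \<Longrightarrow> S1 (x - y) = S1 x - S1 y"
    and S2_diff: "x \<in> DS2 \<Longrightarrow> y \<in> DS2 \<Longrightarrow> S2 (x - y) = S2 x - S2 y"
  using lin_op_diff S1_lin S2_lin by blast+

text \<open>Symmetry of the roots turns the elastic terms into \<open>inner (A1 u) p\<close> and
  \<open>inner (A2 v) q\<close>, which cancel against the equations, as do the coupling terms; only
  the damping remains.\<close>

lemma energy_dissipation_rate:
  assumes "(u, p, v, q) \<in> \<D>"
  shows "inner (S1 u) (S1 p) + inner p (- A1 u - B p - \<alpha> *\<^sub>R v) + inner (S2 v) (S2 q)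
    + inner q (- A2 v - \<alpha> *\<^sub>R u) + \<alpha> * inner p v + \<alpha> * inner u q = - inner (B p) p"
proof -
  have "inner (S1 u) (S1 p) = inner (A1 u) p" "inner (S2 v) (S2 q) = inner (A2 v) q"
    using assms by (auto simp: opA_dom_def DA1_iff A1_eq DA2_iff A2_eq S1_sym S2_sym)
  then show ?thesis
    by (simp add: inner_diff_right inner_diff_left inner_commute algebra_simps)
qed

context
  fixes x assumes x: "x \<in> \<D>"
begin

lemma orbit_component_derivatives:
  assumes t: "0 \<le> t" and Tt: "T t x = (u, p, v, q)"
  shows "((\<lambda>s. S1 (fst (T s x))) has_vector_derivative S1 p) (at t within {0..})"
    and "((\<lambda>s. fst (snd (T s x))) has_vector_derivative - A1 u - B p - \<alpha> *\<^sub>R v) (at t within {0..})"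
    and "((\<lambda>s. S2 (fst (snd (snd (T s x))))) has_vector_derivative S2 q) (at t within {0..})"
    and "((\<lambda>s. snd (snd (snd (T s x)))) has_vector_derivative - A2 v - \<alpha> *\<^sub>R u) (at t within {0..})"
    and "((\<lambda>s. fst (T s x)) has_vector_derivative p) (at t within {0..})"
    and "((\<lambda>s. fst (snd (snd (T s x)))) has_vector_derivative q) (at t within {0..})"
proof -
  have J': "((\<lambda>s. J (T s x)) has_vector_derivative
      (S1 p, - A1 u - B p - \<alpha> *\<^sub>R v, S2 q, - A2 v - \<alpha> *\<^sub>R u)) (at t within {0..})"
    using J_orbit_has_vector_derivative[OF x t] by (simp add: Tt opA_def)
  have J_comp: "fst (J U) = S1 (fst U)" "fst (snd (J U)) = fst (snd U)"
    "fst (snd (snd (J U))) = S2 (fst (snd (snd U)))" "snd (snd (snd (J U))) = snd (snd (snd U))" for U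
    by (cases U; simp)+
  note d = bounded_linear.has_vector_derivative
  show a: "((\<lambda>s. S1 (fst (T s x))) has_vector_derivative S1 p) (at t within {0..})"
    using d[OF bounded_linear_fst J'] by (simp add: J_comp)
  show "((\<lambda>s. fst (snd (T s x))) has_vector_derivative - A1 u - B p - \<alpha> *\<^sub>R v) (at t within {0..})"
    using d[OF bounded_linear_fst d[OF bounded_linear_snd J']] by (simp add: J_comp)
  show b: "((\<lambda>s. S2 (fst (snd (snd (T s x))))) has_vector_derivative S2 q) (at t within {0..})"
    using d[OF bounded_linear_fst d[OF bounded_linear_snd d[OF bounded_linear_snd J']]] by (simp add: J_comp)
  show "((\<lambda>s. snd (snd (snd (T s x)))) has_vector_derivative - A2 v - \<alpha> *\<^sub>R u) (at t within {0..})"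
    using d[OF bounded_linear_snd d[OF bounded_linear_snd d[OF bounded_linear_snd J']]] by (simp add: J_comp)
  have D: "T s x \<in> \<D>" if "0 \<le> s" for s using T_in_D[OF x that] .
  have mem: "fst (T s x) \<in> DS1" "fst (snd (snd (T s x))) \<in> DS2" if "0 \<le> s" for s
    using D[OF that] by (cases "T s x", auto simp: opA_dom_def DA1_iff DA2_iff)+
  have pq: "p \<in> DS1" "q \<in> DS2" using D[OF t] by (auto simp: Tt opA_dom_def)
  \<comment> \<open>The position is recovered from its differentiable image under \<open>S1\<close>
    by the bounded inverse \<open>I1\<close>; \<open>v\<close> is treated likewise with
    \<open>I2\<close>.\<close>
  show "((\<lambda>s. fst (T s x)) has_vector_derivative p) (at t within {0..})"
    using d[OF I1(1) a] t
    by (subst has_vector_derivative_cong_ev[where g = "\<lambda>s. I1 (S1 (fst (T s x)))"])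
      (auto simp: I1(2) mem pq eventually_at_filter)
  show "((\<lambda>s. fst (snd (snd (T s x)))) has_vector_derivative q) (at t within {0..})"
    using d[OF I2(1) b] t
    by (subst has_vector_derivative_cong_ev[where g = "\<lambda>s. I2 (S2 (fst (snd (snd (T s x)))))"])
      (auto simp: I2(2) mem pq eventually_at_filter)
qed

lemma energy_has_derivative:
  assumes t: "0 \<le> t"
  shows "((\<lambda>s. E (T s x)) has_real_derivative - inner (B (fst (snd (T t x)))) (fst (snd (T t x)))) (at t within {0..})"
proof -
  obtain u p v q where Tt: "T t x = (u, p, v, q)" by (cases "T t x")
  have D: "(u, p, v, q) \<in> \<D>" using T_in_D[OF x t] by (simp add: Tt)
  have E: "E U = (inner (S1 (fst U)) (S1 (fst U)) + inner (fst (snd U)) (fst (snd U))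
      + inner (S2 (fst (snd (snd U)))) (S2 (fst (snd (snd U))))
      + inner (snd (snd (snd U))) (snd (snd (snd U))) + 2 * (\<alpha> * inner (fst U) (fst (snd (snd U))))) / 2" for U
    by (cases U) (simp add: energy_def hinner_def inner_commute)
  show ?thesis
    using energy_functional_has_derivative[OF orbit_component_derivatives[OF t Tt], of \<alpha>]
    unfolding Tt fst_conv snd_conv energy_dissipation_rate[OF D] E .
qed

lemma velocity_continuous: "continuous_on {0..} (\<lambda>s. fst (snd (T s x)))"
  unfolding continuous_on_eq_continuous_within
proof
  fix t :: real assume "t \<in> {0..}"
  then show "continuous (at t within {0..}) (\<lambda>s. fst (snd (T s x)))"
    by (cases "T t x") (auto dest: orbit_component_derivatives(2)[THEN has_vector_derivative_continuous, rotated])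
qed

text \<open>Integrating the energy derivative gives an identity with \<open>inner (B p) p\<close>;
  coercivity of \<open>B\<close> turns it into control of the velocity \<open>p\<close> with weight
  \<beta>.\<close>

lemma energy_dissipation:
  assumes t: "0 \<le> t"
  shows "E (T t x) + \<beta> * integral {0..t} (\<lambda>s. (norm (fst (snd (T s x))))\<^sup>2) \<le> E x"
proof -
  let ?p = "\<lambda>s. fst (snd (T s x))"
  have x_in: "x \<in> Hsp DS1 DS2" using x D_sub by blast
  have "((\<lambda>s. - inner (B (?p s)) (?p s)) has_integral E (T t x) - E (T 0 x)) {0..t}"
  proof (rule fundamental_theorem_of_calculus[OF t])
    fix s assume "s \<in> {0..t}"
    then show "((\<lambda>s. E (T s x)) has_vector_derivative - inner (B (?p s)) (?p s)) (at s within {0..t})"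
      using energy_has_derivative[of s]
      by (auto simp: has_real_derivative_iff_has_vector_derivative
          intro: has_vector_derivative_within_subset)
  qed
  then have int: "((\<lambda>s. inner (B (?p s)) (?p s)) has_integral E x - E (T t x)) {0..t}"
    using has_integral_neg[of "\<lambda>s. - inner (B (?p s)) (?p s)" "E (T t x) - E (T 0 x)" "{0..t}"]
      T_zero[OF x_in] by simp
  have cont: "continuous_on {0..t} ?p" using velocity_continuous by (rule continuous_on_subset) auto
  have "\<beta> * integral {0..t} (\<lambda>s. (norm (?p s))\<^sup>2) = integral {0..t} (\<lambda>s. \<beta> * (norm (?p s))\<^sup>2)" by simp
  also have "\<dots> \<le> integral {0..t} (\<lambda>s. inner (B (?p s)) (?p s))"
  proof (rule integral_le)
    show "(\<lambda>s. \<beta> * (norm (?p s))\<^sup>2) integrable_on {0..t}"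
      by (intro integrable_continuous_interval continuous_on_mult_left continuous_on_power
          continuous_on_norm cont)
  qed (use int B_coer in auto)
  also have "\<dots> = E x - E (T t x)" using int by (rule integral_unique)
  finally show ?thesis by simp
qed

end

lemma dom_sub: "U \<in> \<D> \<Longrightarrow> U \<in> Hsp DS1 DS2" using D_sub by blast

lemma energy_decreasing:
  assumes "x \<in> \<D>" "0 \<le> t"
  shows "E (T t x) \<le> E x"
proof -
  have "0 \<le> \<beta> * integral {0..t} (\<lambda>s. (norm (fst (snd (T s x))))\<^sup>2)"
    using \<beta>_pos by (intro mult_nonneg_nonneg Henstock_Kurzweil_Integration.integral_nonneg
        integrable_continuous_interval continuous_on_power continuous_on_norm
        continuous_on_subset[OF velocity_continuous[OF assms(1)]]) auto
  then show ?thesis using energy_dissipation[OF assms] by linarith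
qed

text \<open>The parallelogram identity for \<open>U\<close> and \<open>W - U\<close> makes the gap
  between the two sides equal to \<open>E (2U - W)\<close>.\<close>

lemma energy_add_le:
  assumes "U \<in> Hsp DS1 DS2" "W \<in> Hsp DS1 DS2"
  shows "E W \<le> 2 * E U + 2 * E (W - U)"
proof -
  have nonneg: "0 \<le> E (2 *\<^sub>R U - W)"
    using assms by (intro energy_nonneg subspace_diff[OF sub] subspace_scale[OF sub])
  obtain u p v q u' p' v' q' where UW: "U = (u, p, v, q)" "W = (u', p', v', q')"
    by (cases U; cases W)
  have S: "S1 (u' - u) = S1 u' - S1 u" "S1 (2 *\<^sub>R u - u') = 2 *\<^sub>R S1 u - S1 u'"
    "S2 (v' - v) = S2 v' - S2 v" "S2 (2 *\<^sub>R v - v') = 2 *\<^sub>R S2 v - S2 v'"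
    using assms by (auto simp: UW Hsp_def S1_diff S2_diff S1_scale S2_scale subspace_scale[OF DS1_subspace]
        subspace_scale[OF DS2_subspace])
  have "2 * E U + 2 * E (W - U) - E W = E (2 *\<^sub>R U - W)"
    unfolding UW energy_def hinner_def diff_Pair scaleR_Pair prod.case S
    by (simp add: inner_diff_left inner_diff_right inner_commute add_divide_distrib diff_divide_distrib
        algebra_simps)
  with nonneg show ?thesis by simp
qed

text \<open>The value \<open>\<A> x\<close> lies in the energy space but possibly outside \<D>, so
  dissipation is taken from nearby \<open>w \<in> \<D>\<close>. Squaring the triangle inequality
  costs a factor 2, and comparing \<open>E w\<close> with \<open>E (\<A> x)\<close> another
  2.\<close>

lemma mild_dissipation:
  assumes x: "x \<in> \<D>" and t: "0 \<le> t"
  shows "\<beta> * integral {0..t} (\<lambda>s. (norm (fst (snd (T s (\<A> x)))))\<^sup>2) \<le> 4 * E (\<A> x)"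
proof -
  let ?p = "\<lambda>y s. fst (snd (T s y))"
  have y: "\<A> x \<in> Hsp DS1 DS2" using G_in x by blast
  \<comment> \<open>The error may depend on \<open>t\<close>, since \<open>e\<close> tends to 0 with
    \<open>t\<close> fixed.\<close>
  have le: "\<beta> * integral {0..t} (\<lambda>s. (norm (?p (\<A> x) s))\<^sup>2) \<le> 4 * E (\<A> x) + (4 + 2 * \<beta> * t) * e\<^sup>2"
    if e: "0 < e" for e
  proof -
    obtain w where w: "w \<in> \<D>"
      and ap: "\<And>s. s \<in> {0..t} \<Longrightarrow> norm (J (T s w) - J (T s (\<A> x))) \<le> e"
      using generator_value_approx[OF x t e] by blast
    have wX: "w \<in> Hsp DS1 DS2" using w by (rule dom_sub)
    have near: "norm (?p (\<A> x) s) \<le> norm (?p w s) + e" if s: "s \<in> {0..t}" for s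
    proof -
      have "fst (snd (J (T s w) - J (T s (\<A> x)))) = ?p w s - ?p (\<A> x) s"
        by (cases "T s w"; cases "T s (\<A> x)") simp
      then have "norm (?p w s - ?p (\<A> x) s) \<le> norm (J (T s w) - J (T s (\<A> x)))"
        using norm_fst_snd_le[of "J (T s w) - J (T s (\<A> x))"] by simp
      then show ?thesis using ap[OF s] norm_triangle_sub[of "?p (\<A> x) s" "?p w s"]
        by (simp add: norm_minus_commute)
    qed
    have sq: "(norm (?p (\<A> x) s))\<^sup>2 \<le> 2 * (norm (?p w s))\<^sup>2 + 2 * e\<^sup>2" if s: "s \<in> {0..t}" for s
    proof -
      have "(norm (?p (\<A> x) s))\<^sup>2 \<le> (norm (?p w s) + e)\<^sup>2" using near[OF s] by (intro power_mono) auto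
      also have "\<dots> \<le> 2 * (norm (?p w s))\<^sup>2 + 2 * e\<^sup>2"
        using sum_squares_bound[of "norm (?p w s)" e] by (simp add: power2_sum)
      finally show ?thesis .
    qed
    have "continuous_on {0..} (\<lambda>s. fst (snd (J (T s (\<A> x)))))"
      using J_orbit_continuous[OF y] by (intro continuous_intros)
    moreover have "fst (snd (J U)) = fst (snd U)" for U by (cases U) simp
    ultimately have "continuous_on {0..} (?p (\<A> x))" by simp
    then have c1: "continuous_on {0..t} (?p (\<A> x))" by (rule continuous_on_subset) auto
    have c2: "continuous_on {0..t} (?p w)"
      using velocity_continuous[OF w] by (rule continuous_on_subset) auto
    have i1: "(\<lambda>s. (norm (?p (\<A> x) s))\<^sup>2) integrable_on {0..t}"
      by (intro integrable_continuous_interval continuous_on_power continuous_on_norm c1)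
    have i3: "(\<lambda>s. 2 * (norm (?p w s))\<^sup>2) integrable_on {0..t}"
      by (intro integrable_continuous_interval continuous_on_mult_left continuous_on_power
          continuous_on_norm c2)
    have i2: "(\<lambda>s. 2 * (norm (?p w s))\<^sup>2 + 2 * e\<^sup>2) integrable_on {0..t}"
      by (intro integrable_add i3 integrable_const_ivl)
    have "E (w - \<A> x) \<le> (norm (J (w - \<A> x)))\<^sup>2"
      by (intro energy_upper subspace_diff[OF sub] wX y)
    also have "\<dots> \<le> e\<^sup>2"
      using ap[of 0] t by (intro power_mono) (auto simp: J_diff wX y T_zero)
    finally have Ew: "E w \<le> 2 * E (\<A> x) + 2 * e\<^sup>2" using energy_add_le[OF y wX] by linarith
    have "integral {0..t} (\<lambda>s. (norm (?p (\<A> x) s))\<^sup>2)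
        \<le> integral {0..t} (\<lambda>s. 2 * (norm (?p w s))\<^sup>2 + 2 * e\<^sup>2)"
      using sq by (intro integral_le i1 i2)
    also have "\<dots> = 2 * integral {0..t} (\<lambda>s. (norm (?p w s))\<^sup>2) + 2 * e\<^sup>2 * t"
      using t i3 by (subst integral_add) auto
    finally have "\<beta> * integral {0..t} (\<lambda>s. (norm (?p (\<A> x) s))\<^sup>2)
        \<le> \<beta> * (2 * integral {0..t} (\<lambda>s. (norm (?p w s))\<^sup>2) + 2 * e\<^sup>2 * t)"
      using \<beta>_pos by (intro mult_left_mono) auto
    moreover have "\<beta> * integral {0..t} (\<lambda>s. (norm (?p w s))\<^sup>2) \<le> E w"
      using energy_dissipation[OF w t] energy_nonneg[OF dom_sub[OF T_in_D[OF w t]]] by simp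
    ultimately show ?thesis using Ew by (simp add: algebra_simps)
  qed
  have "((\<lambda>e. 4 * E (\<A> x) + (4 + 2 * \<beta> * t) * e\<^sup>2) \<longlongrightarrow> 4 * E (\<A> x) + (4 + 2 * \<beta> * t) * 0\<^sup>2) (at_right 0)"
    by (intro tendsto_intros)
  then have "\<beta> * integral {0..t} (\<lambda>s. (norm (?p (\<A> x) s))\<^sup>2) \<le> 4 * E (\<A> x) + (4 + 2 * \<beta> * t) * 0\<^sup>2"
    by (rule tendsto_lowerbound) (auto simp: eventually_at_right_field intro!: exI[of _ 1] le)
  then show ?thesis by simp
qed

end

section \<open>The multiplier estimate\<close>

lemma Young_scaled:
  fixes x y e :: real
  assumes "0 < e"
  shows "x * y \<le> e * y\<^sup>2 + x\<^sup>2 / (4 * e)"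
proof -
  have "0 \<le> (2 * e * y - x)\<^sup>2 / (4 * e)" using assms by simp
  also have "\<dots> = e * y\<^sup>2 + x\<^sup>2 / (4 * e) - x * y"
    using assms by (simp add: power2_diff field_simps power2_eq_square)
  finally show ?thesis by simp
qed

text \<open>The indirect observation of \<open>v'\<close> through \<open>u\<close>: \<open>n\<close> stands for \<open>\<parallel>v'\<parallel>\<close>, \<open>x\<^sub>j\<close> for
  \<open>\<parallel>u\<^sup>(\<^sup>j\<^sup>)\<parallel>\<close>, \<open>s\<^sub>j\<close> for \<open>\<parallel>A\<^sub>1\<^sup>1\<^sup>/\<^sup>2 u\<^sup>(\<^sup>j\<^sup>)\<parallel>\<close>, while \<open>f\<close> and \<open>g\<close> are total time derivatives.
  All occurrences of \<open>n\<close> on the right are absorbed by Young's inequality.\<close>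

lemma multiplier_absorption:
  fixes a b r n f g x1 x2 x3 x4 x5 s1 s3 :: real
  defines "C \<equiv> 2 / a + 2 * b\<^sup>2 / a + 2 * r\<^sup>2 / a * (1 + b) + (1 + b) + 4 * a + (a * r)\<^sup>2 / 4 + 16 * r ^ 4 / a"
  assumes a: "0 < a" and b: "0 \<le> b" and r: "0 \<le> r"
    and main: "a * n\<^sup>2 \<le> f + x3 * n + b * x2 * n + r * s3 * n + a * r * x1 * s1"
    and s3: "s3\<^sup>2 \<le> x5 * x3 + b * (x4 * x3) - g + a * (n * x5)"
    and s1: "s1\<^sup>2 \<le> x3 * x1 + b * (x2 * x1) + a * (n * x1)"
  shows "a / 2 * n\<^sup>2 \<le> f - 2 * r\<^sup>2 / a * g + C * (x1\<^sup>2 + x2\<^sup>2 + x3\<^sup>2 + x4\<^sup>2 + x5\<^sup>2)"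
proof -
  define Q where "Q = x1\<^sup>2 + x2\<^sup>2 + x3\<^sup>2 + x4\<^sup>2 + x5\<^sup>2"
  have Q: "x1\<^sup>2 \<le> Q" "x2\<^sup>2 \<le> Q" "x3\<^sup>2 \<le> Q" "x5\<^sup>2 \<le> Q" by (auto simp: Q_def)
  have half: "y * z \<le> y\<^sup>2 / 2 + z\<^sup>2 / 2" for y z :: real
    using Young_scaled[of "1/2" y z] by simp
  have pr: "x5 * x3 \<le> Q" "x4 * x3 \<le> Q" "x3 * x1 \<le> Q" "x2 * x1 \<le> Q"
    using half[of x5 x3] half[of x4 x3] half[of x3 x1] half[of x2 x1] zero_le_power2[of x1]
      zero_le_power2[of x2] zero_le_power2[of x3] zero_le_power2[of x4] zero_le_power2[of x5]
    unfolding Q_def by argo+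
  \<comment> \<open>The Young weights are allotted so that \<open>n^2\<close> appears three times
    with \<open>a/8\<close> and twice with \<open>a/16\<close>: half of \<open>a * n^2\<close> is
    absorbed and half is kept.\<close>
  have y1: "x3 * n \<le> a / 8 * n\<^sup>2 + 2 / a * Q"
    using Young_scaled[of "a/8" x3 n] mult_left_mono[OF Q(3), of "2 / a"] a by simp
  have y2: "b * x2 * n \<le> a / 8 * n\<^sup>2 + 2 * b\<^sup>2 / a * Q"
    using Young_scaled[of "a/8" "b * x2" n] mult_left_mono[OF Q(2), of "2 * b\<^sup>2 / a"] a
    by (simp add: power_mult_distrib)
  have y3: "r * s3 * n \<le> a / 8 * n\<^sup>2 + 2 * r\<^sup>2 / a * s3\<^sup>2"
    using Young_scaled[of "a/8" "r * s3" n] a by (simp add: power_mult_distrib)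
  have y4: "a * r * x1 * s1 \<le> s1\<^sup>2 + (a * r)\<^sup>2 / 4 * Q"
    using Young_scaled[of 1 "a * r * x1" s1] mult_left_mono[OF Q(1), of "(a * r)\<^sup>2 / 4"]
    by (simp add: power_mult_distrib)
  have y5: "a * (n * x1) \<le> a / 16 * n\<^sup>2 + 4 * a * Q"
  proof -
    have "a * (n * x1) \<le> a / 16 * n\<^sup>2 + 4 * a * x1\<^sup>2"
      using Young_scaled[of "a/16" "a * x1" n] a by (simp add: power2_eq_square ac_simps)
    moreover have "4 * a * x1\<^sup>2 \<le> 4 * a * Q" using Q(1) a by (intro mult_left_mono) auto
    ultimately show ?thesis by linarith
  qed
  have y6: "2 * r\<^sup>2 / a * (a * (n * x5)) \<le> a / 16 * n\<^sup>2 + 16 * r ^ 4 / a * Q"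
  proof -
    have "2 * r\<^sup>2 / a * (a * (n * x5)) = (2 * r\<^sup>2 * x5) * n" using a by simp
    also have "\<dots> \<le> a / 16 * n\<^sup>2 + 16 * r ^ 4 / a * x5\<^sup>2"
      using Young_scaled[of "a/16" "2 * r\<^sup>2 * x5" n] a
      by (simp add: power_mult_distrib power_mult[symmetric])
    also have "\<dots> \<le> a / 16 * n\<^sup>2 + 16 * r ^ 4 / a * Q"
      using mult_left_mono[OF Q(4), of "16 * r ^ 4 / a"] a r by simp
    finally show ?thesis .
  qed
  \<comment> \<open>\<open>y3\<close> produces \<open>s3^2\<close> with coefficient
    \<open>2 * r^2 / a\<close>. Multiplying the bound for \<open>s3^2\<close> by it fixes the
    coefficient of \<open>g\<close> in the conclusion.\<close>
  have t3: "2 * r\<^sup>2 / a * s3\<^sup>2 \<le> 2 * r\<^sup>2 / a * (1 + b) * Q - 2 * r\<^sup>2 / a * g + (a / 16 * n\<^sup>2 + 16 * r ^ 4 / a * Q)"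
  proof -
    have "s3\<^sup>2 \<le> (1 + b) * Q - g + a * (n * x5)"
      using s3 pr(1) mult_left_mono[OF pr(2) b] by (simp add: algebra_simps)
    then have "2 * r\<^sup>2 / a * s3\<^sup>2 \<le> 2 * r\<^sup>2 / a * ((1 + b) * Q - g + a * (n * x5))"
      using a by (intro mult_left_mono) auto
    also have "\<dots> = 2 * r\<^sup>2 / a * (1 + b) * Q - 2 * r\<^sup>2 / a * g + 2 * r\<^sup>2 / a * (a * (n * x5))"
      by (simp only: ring_distribs mult.assoc)
    finally show ?thesis using y6 by linarith
  qed
  have t1: "s1\<^sup>2 \<le> (1 + b) * Q + (a / 16 * n\<^sup>2 + 4 * a * Q)"
    using s1 pr(3) mult_left_mono[OF pr(4) b] y5 by (simp add: algebra_simps)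
  have "C * Q = 2 / a * Q + 2 * b\<^sup>2 / a * Q + 2 * r\<^sup>2 / a * (1 + b) * Q + (1 + b) * Q + 4 * a * Q
      + (a * r)\<^sup>2 / 4 * Q + 16 * r ^ 4 / a * Q"
    unfolding C_def by (simp only: ring_distribs)
  moreover have "a * n\<^sup>2 = a / 2 * n\<^sup>2 + 3 * (a / 8 * n\<^sup>2) + 2 * (a / 16 * n\<^sup>2)" by simp
  ultimately show ?thesis
    unfolding Q_def[symmetric] using main y1 y2 y3 y4 t3 t1 by linarith
qed

lemma inner_has_real_derivative:
  assumes "(f has_vector_derivative f') (at t within X)" "(g has_vector_derivative g') (at t within X)"
  shows "((\<lambda>s. inner (f s) (g s)) has_real_derivative inner (f t) g' + inner f' (g t)) (at t within X)"
  using bounded_bilinear.has_vector_derivative[OF bounded_bilinear_inner assms]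
  by (simp add: has_real_derivative_iff_has_vector_derivative)

section \<open>Time derivatives of a regular orbit\<close>

context coupled_system
begin

text \<open>The time derivatives \<open>u\<^sup>(\<^sup>k\<^sup>)\<close> and \<open>v\<^sup>(\<^sup>k\<^sup>)\<close>; they are read off the velocity components so that
  the index \<open>k = 5\<close>, which is not a position component of any \<open>\<A>\<^sup>k x\<close>, is covered.\<close>

definition du :: "'a st \<Rightarrow> nat \<Rightarrow> real \<Rightarrow> 'a" where
  "du x k t = (case k of 0 \<Rightarrow> fst (T t x) | Suc j \<Rightarrow> fst (snd (T t ((\<A> ^^ j) x))))"

definition dv :: "'a st \<Rightarrow> nat \<Rightarrow> real \<Rightarrow> 'a" where
  "dv x k t = (case k of 0 \<Rightarrow> fst (snd (snd (T t x))) | Suc j \<Rightarrow> snd (snd (snd (T t ((\<A> ^^ j) x)))))"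

text \<open>The indices 0 to 3 encode that \<open>x\<close> lies in the domain of the fourth power
  of \<A>; the fourth iterate itself is only known to lie in the energy space.\<close>

context
  fixes x assumes chain: "\<And>k. k \<le> 3 \<Longrightarrow> (\<A> ^^ k) x \<in> \<D>"
begin

text \<open>The index 4 is admissible because the flow commutes with \<A> at the third iterate; the
  position components of \<open>\<A> U\<close> are the velocities of \<open>U\<close>.\<close>

lemma flow_components:
  assumes k: "k \<le> 4" and t: "0 \<le> t"
  shows "T t ((\<A> ^^ k) x) = (du x k t, du x (Suc k) t, dv x k t, dv x (Suc k) t)"
proof (cases k)
  case 0
  then show ?thesis by (simp add: du_def dv_def)
next
  case (Suc j)
  have "T t ((\<A> ^^ k) x) = \<A> (T t ((\<A> ^^ j) x))"
    using G_T[OF chain t, of j] k by (simp add: Suc)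
  then show ?thesis
    by (cases "T t ((\<A> ^^ j) x)"; cases "T t ((\<A> ^^ k) x)") (auto simp: du_def dv_def opA_def Suc)
qed

lemma
  assumes k: "k \<le> 3" and t: "0 \<le> t"
  shows du_DA1: "du x k t \<in> DA1" and du_DS1: "du x (Suc k) t \<in> DS1"
    and dv_DA2: "dv x k t \<in> DA2" and dv_DS2: "dv x (Suc k) t \<in> DS2"
    and du_eq: "du x (Suc (Suc k)) t = - A1 (du x k t) - B (du x (Suc k) t) - \<alpha> *\<^sub>R dv x k t"
    and dv_eq: "dv x (Suc (Suc k)) t = - A2 (dv x k t) - \<alpha> *\<^sub>R du x k t"
proof -
  note fl = flow_components[of k t]
  have "T t ((\<A> ^^ k) x) \<in> \<D>" using T_in_D[OF chain t] k by simp
  then show "du x k t \<in> DA1" "du x (Suc k) t \<in> DS1" "dv x k t \<in> DA2" "dv x (Suc k) t \<in> DS2"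
    using fl k t by (auto simp: opA_dom_def)
  have "T t ((\<A> ^^ Suc k) x) = \<A> (T t ((\<A> ^^ k) x))"
    using G_T[OF chain t, of k] k by simp
  then show "du x (Suc (Suc k)) t = - A1 (du x k t) - B (du x (Suc k) t) - \<alpha> *\<^sub>R dv x k t"
    "dv x (Suc (Suc k)) t = - A2 (dv x k t) - \<alpha> *\<^sub>R du x k t"
    using fl flow_components[of "Suc k" t] k t by (auto simp: opA_def)
qed

text \<open>For positive \<open>k\<close> the curve is a velocity component of iterate
  \<open>k - 1\<close>, which lies in \<D> even for \<open>k = 4\<close>; the system equations
  identify its derivative.\<close>

lemma
  assumes k: "k \<le> 4" and t: "0 \<le> t"
  shows du_deriv: "(du x k has_vector_derivative du x (Suc k) t) (at t within {0..})"
    and dv_deriv: "(dv x k has_vector_derivative dv x (Suc k) t) (at t within {0..})"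
proof -
  have "(du x k has_vector_derivative du x (Suc k) t) (at t within {0..}) \<and>
    (dv x k has_vector_derivative dv x (Suc k) t) (at t within {0..})"
  proof (cases k)
    case 0
    have x: "x \<in> \<D>" using chain[of 0] by simp
    show ?thesis
      using orbit_component_derivatives(5,6)[OF x t flow_components[of 0 t, simplified, OF t]]
      by (simp add: 0 du_def[of x 0, abs_def] dv_def[of x 0, abs_def])
  next
    case (Suc j)
    then have j: "j \<le> 3" "j \<le> 4" using k by auto
    show ?thesis
      using orbit_component_derivatives(2,4)[OF chain[OF j(1)] t flow_components[OF j(2) t]]
      unfolding Suc du_eq[OF j(1) t] dv_eq[OF j(1) t]
      by (simp add: du_def[of x "Suc j", abs_def] dv_def[of x "Suc j", abs_def])
  qed
  then show "(du x k has_vector_derivative du x (Suc k) t) (at t within {0..})"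
    "(dv x k has_vector_derivative dv x (Suc k) t) (at t within {0..})" by auto
qed

lemma S1_du_deriv:
  assumes k: "k \<le> 3" and t: "0 \<le> t"
  shows "((\<lambda>s. S1 (du x k s)) has_vector_derivative S1 (du x (Suc k) t)) (at t within {0..})"
proof (rule has_vector_derivative_transform)
  show "((\<lambda>s. S1 (fst (T s ((\<A> ^^ k) x)))) has_vector_derivative S1 (du x (Suc k) t)) (at t within {0..})"
    using orbit_component_derivatives(1)[OF chain[OF k] t flow_components[of k t]] k t by simp
  show "S1 (du x k s) = S1 (fst (T s ((\<A> ^^ k) x)))" if "s \<in> {0..}" for s
    using flow_components[of k s] k that by simp
qed (use t in simp)

text \<open>Coercivity and decay of the energy give bounds independent of \<open>t\<close>, used to
  control the multiplier at the endpoints of the time interval.\<close>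

lemma energy_state_bounds:
  assumes k: "k \<le> 3" and t: "0 \<le> t"
  shows "\<kappa> * (norm (du x k t))\<^sup>2 * \<omega>1 \<le> 2 * E ((\<A> ^^ k) x)"
    and "\<kappa> * (norm (dv x k t))\<^sup>2 * \<omega>2 \<le> 2 * E ((\<A> ^^ k) x)"
    and "\<kappa> * (norm (S1 (du x k t)))\<^sup>2 \<le> 2 * E ((\<A> ^^ k) x)"
    and "\<kappa> * (norm (du x (Suc k) t))\<^sup>2 \<le> 2 * E ((\<A> ^^ k) x)"
    and "\<kappa> * (norm (dv x (Suc k) t))\<^sup>2 \<le> 2 * E ((\<A> ^^ k) x)"
proof -
  define e where "e = 2 * E ((\<A> ^^ k) x)"
  have D: "T t ((\<A> ^^ k) x) \<in> \<D>" using T_in_D[OF chain[OF k] t] .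
  have "\<kappa> * (norm (J (T t ((\<A> ^^ k) x))))\<^sup>2 \<le> e"
    using energy_lower[OF dom_sub[OF D]] energy_decreasing[OF chain[OF k] t] by (simp add: e_def)
  moreover have "T t ((\<A> ^^ k) x) = (du x k t, du x (Suc k) t, dv x k t, dv x (Suc k) t)"
    using flow_components[of k t] k t by simp
  ultimately have sum: "\<kappa> * ((norm (S1 (du x k t)))\<^sup>2 + (norm (du x (Suc k) t))\<^sup>2
      + (norm (S2 (dv x k t)))\<^sup>2 + (norm (dv x (Suc k) t))\<^sup>2) \<le> e" by (simp only: norm_J)
  have pick: "\<kappa> * y \<le> e" if "y \<le> (norm (S1 (du x k t)))\<^sup>2 + (norm (du x (Suc k) t))\<^sup>2
      + (norm (S2 (dv x k t)))\<^sup>2 + (norm (dv x (Suc k) t))\<^sup>2" for y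
    using mult_left_mono[OF that, of \<kappa>] \<kappa>_pos sum by linarith
  have "\<omega>1 * (norm (du x k t))\<^sup>2 \<le> (norm (S1 (du x k t)))\<^sup>2"
    using du_DA1[OF k t] by (intro S1_form) (simp add: DA1_iff)
  then have "\<kappa> * (\<omega>1 * (norm (du x k t))\<^sup>2) \<le> e" by (intro pick) (simp add: add_increasing2)
  then show "\<kappa> * (norm (du x k t))\<^sup>2 * \<omega>1 \<le> 2 * E ((\<A> ^^ k) x)" by (simp add: e_def ac_simps)
  have "\<omega>2 * (norm (dv x k t))\<^sup>2 \<le> (norm (S2 (dv x k t)))\<^sup>2"
    using dv_DA2[OF k t] by (intro S2_form) (simp add: DA2_iff)
  then have "\<kappa> * (\<omega>2 * (norm (dv x k t))\<^sup>2) \<le> e" by (intro pick) (simp add: add_increasing2 add_increasing)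
  then show "\<kappa> * (norm (dv x k t))\<^sup>2 * \<omega>2 \<le> 2 * E ((\<A> ^^ k) x)" by (simp add: e_def ac_simps)
  show "\<kappa> * (norm (S1 (du x k t)))\<^sup>2 \<le> 2 * E ((\<A> ^^ k) x)"
    "\<kappa> * (norm (du x (Suc k) t))\<^sup>2 \<le> 2 * E ((\<A> ^^ k) x)"
    "\<kappa> * (norm (dv x (Suc k) t))\<^sup>2 \<le> 2 * E ((\<A> ^^ k) x)"
    unfolding e_def[symmetric] by (intro pick, simp)+
qed

text \<open>The factor 4 comes from \<open>k = 4\<close>, where only the approximation argument
  applies; the lower orders satisfy the bound with room to spare.\<close>

lemma velocity_integral:
  assumes k: "k \<le> 4" and t: "0 \<le> t"
  shows "\<beta> * integral {0..t} (\<lambda>s. (norm (du x (Suc k) s))\<^sup>2) \<le> 4 * E ((\<A> ^^ k) x)"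
proof (cases "k = 4")
  case True
  then have "(\<A> ^^ k) x = \<A> ((\<A> ^^ 3) x)" by (simp add: eval_nat_numeral)
  then show ?thesis using mild_dissipation[OF chain[of 3] t] by (simp add: du_def)
next
  case False
  then have "(\<A> ^^ k) x \<in> \<D>" using chain k by simp
  from energy_dissipation[OF this t] energy_nonneg[OF dom_sub[OF T_in_D[OF this t]]]
    energy_nonneg[OF dom_sub[OF this]]
  show ?thesis by (simp add: du_def)
qed

end

end

section \<open>Pointwise and integrated multiplier inequalities\<close>

lemma abs_inner_le:
  assumes "(norm y)\<^sup>2 \<le> W" "(norm z)\<^sup>2 \<le> W"
  shows "\<bar>inner y z\<bar> \<le> W"
proof -
  have "\<bar>inner y z\<bar> \<le> norm y * norm z" by (rule Cauchy_Schwarz_ineq2)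
  moreover have "2 * (norm y * norm z) \<le> (norm y)\<^sup>2 + (norm z)\<^sup>2"
    using sum_squares_bound[of "norm y" "norm z"] by simp
  ultimately show ?thesis using assms by linarith
qed

lemma abs_inner_bounded_le:
  assumes y: "(norm y)\<^sup>2 \<le> W" and z: "(norm z)\<^sup>2 \<le> W" and F: "norm Fz \<le> k * norm z" and k: "0 \<le> k"
  shows "\<bar>inner y Fz\<bar> \<le> k * W"
proof -
  have "\<bar>inner y Fz\<bar> \<le> norm y * norm Fz" by (rule Cauchy_Schwarz_ineq2)
  also have "\<dots> \<le> norm y * (k * norm z)" by (intro mult_left_mono F) auto
  also have "\<dots> = k * (norm y * norm z)" by simp
  also have "\<dots> \<le> k * W"
    using sum_squares_bound[of "norm y" "norm z"] y z by (intro mult_left_mono k) linarith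
  finally show ?thesis .
qed

context coupled_system
begin

text \<open>This is the constant of \<open>multiplier_absorption\<close> for
  \<open>a = \<bar>\<alpha>\<bar>\<close> and \<open>r = c\<close>, with \<open>b\<close> a norm
  bound for \<open>B\<close>.\<close>

definition absorption_const :: "real \<Rightarrow> real" where
  "absorption_const b = 2 / \<bar>\<alpha>\<bar> + 2 * b\<^sup>2 / \<bar>\<alpha>\<bar> + 2 * c\<^sup>2 / \<bar>\<alpha>\<bar> * (1 + b) + (1 + b) + 4 * \<bar>\<alpha>\<bar>
    + (\<bar>\<alpha>\<bar> * c)\<^sup>2 / 4 + 16 * c ^ 4 / \<bar>\<alpha>\<bar>"

text \<open>The first bracket holds the boundary terms from moving time derivatives off
  \<open>v'''\<close>, weighted as in the absorption step. The last bracket comes from testing the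
  system with \<open>u\<close> and \<open>v\<close>; the factor
  \<open>4 / \<bar>\<alpha>\<bar>\<close> raises \<open>\<bar>\<alpha>\<bar> / 2\<close> times the
  square of \<open>norm v'\<close> to twice that square.\<close>

definition multiplier :: "'a st \<Rightarrow> real \<Rightarrow> real" where
  "multiplier x s =
    4 / \<bar>\<alpha>\<bar> * (sgn \<alpha> * (inner (S1 (du x 1 s)) (R (dv x 2 s)) - inner (S1 (du x 2 s)) (R (dv x 1 s)))
      - 2 * c\<^sup>2 / \<bar>\<alpha>\<bar> * (\<alpha> * (inner (dv x 2 s) (du x 3 s) - inner (dv x 1 s) (du x 4 s))))
    - (inner (du x 1 s) (du x 0 s) + inner (dv x 1 s) (dv x 0 s) + inner (B (du x 0 s)) (du x 0 s) / 2)"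

definition multiplier_deriv :: "'a st \<Rightarrow> real \<Rightarrow> real" where
  "multiplier_deriv x s =
    4 / \<bar>\<alpha>\<bar> * (sgn \<alpha> * (inner (S1 (du x 1 s)) (R (dv x 3 s)) - inner (S1 (du x 3 s)) (R (dv x 1 s)))
      - 2 * c\<^sup>2 / \<bar>\<alpha>\<bar> * (\<alpha> * (inner (dv x 3 s) (du x 3 s) - inner (dv x 1 s) (du x 5 s))))
    - ((norm (du x 1 s))\<^sup>2 + inner (du x 2 s) (du x 0 s) + (norm (dv x 1 s))\<^sup>2
      + inner (dv x 2 s) (dv x 0 s) + inner (B (du x 1 s)) (du x 0 s))"

definition total_energy :: "'a st \<Rightarrow> real" where
  "total_energy x = (\<Sum>k\<le>4. E ((\<A> ^^ k) x))"

text \<open>Shifting the index collects the orders 1 to 5 of \<open>u\<close>, the velocities that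
  damping controls along the iterates 0 to 4.\<close>

definition observed :: "'a st \<Rightarrow> real \<Rightarrow> real" where
  "observed x s = (\<Sum>j\<le>4. (norm (du x (Suc j) s))\<^sup>2)"

context
  fixes x assumes chain: "\<And>k. k \<le> 3 \<Longrightarrow> (\<A> ^^ k) x \<in> \<D>"
begin

text \<open>Within each difference the intermediate products \<open>inner (S1 u'') (R v'')\<close>
  and \<open>inner v'' u''''\<close> cancel; symmetry of \<open>B\<close> removes the factor one
  half.\<close>

lemma multiplier_has_derivative:
  assumes t: "0 \<le> t"
  shows "(multiplier x has_real_derivative multiplier_deriv x t) (at t within {0..})"
proof -
  note u = du_deriv[OF chain _ t] and v = dv_deriv[OF chain _ t] and s = S1_du_deriv[OF chain _ t]
  have u': "(du x 0 has_vector_derivative du x 1 t) (at t within {0..})"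
    "(du x 1 has_vector_derivative du x 2 t) (at t within {0..})"
    "(du x 3 has_vector_derivative du x 4 t) (at t within {0..})"
    "(du x 4 has_vector_derivative du x 5 t) (at t within {0..})"
    using u[of 0] u[of 1] u[of 3] u[of 4] by (simp_all add: eval_nat_numeral)
  have v': "(dv x 0 has_vector_derivative dv x 1 t) (at t within {0..})"
    "(dv x 1 has_vector_derivative dv x 2 t) (at t within {0..})"
    "(dv x 2 has_vector_derivative dv x 3 t) (at t within {0..})"
    using v[of 0] v[of 1] v[of 2] by (simp_all add: eval_nat_numeral)
  have s': "((\<lambda>s. S1 (du x 1 s)) has_vector_derivative S1 (du x 2 t)) (at t within {0..})"
    "((\<lambda>s. S1 (du x 2 s)) has_vector_derivative S1 (du x 3 t)) (at t within {0..})"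
    using s[of 1] s[of 2] by (simp_all add: eval_nat_numeral)
  note i = inner_has_real_derivative
  note Rd = bounded_linear.has_vector_derivative[OF R_bl]
  note Bd = bounded_linear.has_vector_derivative[OF B_bl]
  have d1: "((\<lambda>s. inner (S1 (du x 1 s)) (R (dv x 2 s)) - inner (S1 (du x 2 s)) (R (dv x 1 s)))
      has_real_derivative inner (S1 (du x 1 t)) (R (dv x 3 t)) - inner (S1 (du x 3 t)) (R (dv x 1 t)))
      (at t within {0..})"
    using DERIV_diff[OF i[OF s'(1) Rd[OF v'(3)]] i[OF s'(2) Rd[OF v'(2)]]] by (simp add: algebra_simps)
  have d2: "((\<lambda>s. inner (dv x 2 s) (du x 3 s) - inner (dv x 1 s) (du x 4 s))
      has_real_derivative inner (dv x 3 t) (du x 3 t) - inner (dv x 1 t) (du x 5 t)) (at t within {0..})"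
    using DERIV_diff[OF i[OF v'(3) u'(3)] i[OF v'(2) u'(4)]] by (simp add: algebra_simps)
  have d3: "((\<lambda>s. inner (du x 1 s) (du x 0 s) + inner (dv x 1 s) (dv x 0 s)
        + inner (B (du x 0 s)) (du x 0 s) / 2) has_real_derivative
      (norm (du x 1 t))\<^sup>2 + inner (du x 2 t) (du x 0 t) + (norm (dv x 1 t))\<^sup>2
      + inner (dv x 2 t) (dv x 0 t) + inner (B (du x 1 t)) (du x 0 t)) (at t within {0..})"
    using DERIV_add[OF DERIV_add[OF i[OF u'(2) u'(1)] i[OF v'(2) v'(1)]]
        DERIV_cdivide[OF i[OF Bd[OF u'(1)] u'(1)], of 2]]
    by (simp add: power2_norm_eq_inner B_sym[of "du x 0 t"] inner_commute[of "du x 0 t"] add.assoc)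
  show ?thesis
    unfolding multiplier_def[abs_def] multiplier_deriv_def
    by (rule DERIV_diff[OF DERIV_cmult[OF DERIV_diff[OF DERIV_cmult[OF d1] DERIV_cmult[OF DERIV_cmult[OF d2]]]] d3])
qed

text \<open>The energy is written through the kinetic terms up to a time derivative, and the
  undamped term \<open>norm v1\<close> is then bounded by indirect observation.\<close>

lemma energy_le_multiplier_deriv:
  assumes s: "0 \<le> s" and b: "0 \<le> b" and B: "\<And>u. norm (B u) \<le> b * norm u"
  shows "2 * E (T s x) \<le> multiplier_deriv x s + (2 + 4 / \<bar>\<alpha>\<bar> * absorption_const b) * observed x s"
proof -
  define u0 u1 u2 u3 u4 u5 where u_defs: "u0 = du x 0 s" "u1 = du x 1 s" "u2 = du x 2 s"
    "u3 = du x 3 s" "u4 = du x 4 s" "u5 = du x 5 s"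
  define v0 v1 v2 v3 where v_defs: "v0 = dv x 0 s" "v1 = dv x 1 s" "v2 = dv x 2 s" "v3 = dv x 3 s"
  note u_folds = u_defs[symmetric] v_defs[symmetric]
  have Q: "observed x s = (norm u1)\<^sup>2 + (norm u2)\<^sup>2 + (norm u3)\<^sup>2 + (norm u4)\<^sup>2 + (norm u5)\<^sup>2"
    by (simp add: observed_def u_defs eval_nat_numeral)
  have mem: "u0 \<in> DA1" "u1 \<in> DA1" "u3 \<in> DA1" "v0 \<in> DA2" "v1 \<in> DA2"
    using du_DA1[OF chain _ s, of 0] du_DA1[OF chain _ s, of 1] du_DA1[OF chain _ s, of 3]
      dv_DA2[OF chain _ s, of 0] dv_DA2[OF chain _ s, of 1] by (auto simp: u_defs v_defs)
  have eqs: "A1 u0 = - u2 - B u1 - \<alpha> *\<^sub>R v0" "A1 u1 = - u3 - B u2 - \<alpha> *\<^sub>R v1"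
    "A1 u3 = - u5 - B u4 - \<alpha> *\<^sub>R v3" "A2 v0 = - v2 - \<alpha> *\<^sub>R u0" "A2 v1 = - v3 - \<alpha> *\<^sub>R u1"
    using du_eq[OF chain _ s, of 0] du_eq[OF chain _ s, of 1] du_eq[OF chain _ s, of 3]
      dv_eq[OF chain _ s, of 0] dv_eq[OF chain _ s, of 1]
    by (simp_all add: u_defs v_defs eval_nat_numeral)
  have form1: "(norm (S1 w))\<^sup>2 = inner (A1 w) w" if "w \<in> DA1" for w
    using that S1_sym[of "S1 w" w] by (simp add: DA1_iff A1_eq power2_norm_eq_inner)
  have form2: "(norm (S2 w))\<^sup>2 = inner (A2 w) w" if "w \<in> DA2" for w
    using that S2_sym[of "S2 w" w] by (simp add: DA2_iff A2_eq power2_norm_eq_inner)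
  have CS: "- inner y z \<le> norm y * norm z" for y z :: 'a
    using Cauchy_Schwarz_ineq2[of y z] by auto
  have CSB: "- inner (B y) z \<le> b * (norm y * norm z)" for y z
    using CS[of "B y" z] mult_right_mono[OF B[of y], of "norm z"] by simp
  have a: "0 < \<bar>\<alpha>\<bar>" using \<alpha>_nonzero by simp
  define F where "F = inner (S1 u1) (R v3) - inner (S1 u3) (R v1)"
  define g where "g = \<alpha> * (inner v3 u3 - inner v1 u5)"
  \<comment> \<open>\<open>R\<close> is applied to the second equation at order 1, where
    \<open>R (A2 v1) = S1 v1\<close>.\<close>
  have S1v1: "S1 v1 = - R v3 - \<alpha> *\<^sub>R R u1"
  proof -
    interpret bounded_linear R by (rule R_bl)
    show ?thesis using R_A2[OF mem(5)] by (simp add: eqs diff neg scale)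
  qed
  have "\<alpha> * (norm v1)\<^sup>2 = - inner u3 v1 - inner (B u2) v1 - inner (A1 u1) v1"
    by (simp add: eqs inner_diff_left power2_norm_eq_inner)
  \<comment> \<open>Moving one root onto \<open>v1\<close> requires \<open>v1 \<in> DS1\<close>,
    which follows from \<open>DA2 \<subseteq> DS1\<close>.\<close>
  also have "inner (A1 u1) v1 = inner (S1 u1) (S1 v1)"
    using mem dom_incl S1_sym[of "S1 u1" v1] by (auto simp: DA1_iff A1_eq)
  finally have id: "\<alpha> * (norm v1)\<^sup>2 = F + (- inner u3 v1 - inner (B u2) v1 + inner (S1 u3) (R v1)
      + \<alpha> * inner (S1 u1) (R u1))" (is "_ = F + ?rest")
    by (simp add: S1v1 F_def inner_diff_right)
  \<comment> \<open>Multiplying by the sign of \<alpha> makes the left side positive for either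
    sign; this is why \<open>sgn \<alpha>\<close> occurs in the multiplier.\<close>
  have "\<bar>\<alpha>\<bar> * (norm v1)\<^sup>2 = sgn \<alpha> * (\<alpha> * (norm v1)\<^sup>2)"
    by (simp add: abs_sgn_eq abs_if sgn_if)
  also have "\<dots> = sgn \<alpha> * F + sgn \<alpha> * ?rest" unfolding id by (rule distrib_left)
  also have "sgn \<alpha> * ?rest \<le> \<bar>?rest\<bar>" by (auto simp: sgn_if abs_if)
  also have "\<bar>?rest\<bar> \<le> \<bar>inner u3 v1\<bar> + \<bar>inner (B u2) v1\<bar> + \<bar>inner (S1 u3) (R v1)\<bar>
      + \<bar>\<alpha>\<bar> * \<bar>inner (S1 u1) (R u1)\<bar>" by (simp add: abs_mult[symmetric])
  also have "\<dots> \<le> norm u3 * norm v1 + b * norm u2 * norm v1 + c * norm (S1 u3) * norm v1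
      + \<bar>\<alpha>\<bar> * c * norm u1 * norm (S1 u1)"
  proof (intro add_mono)
    show "\<bar>inner u3 v1\<bar> \<le> norm u3 * norm v1" by (rule Cauchy_Schwarz_ineq2)
    show "\<bar>inner (B u2) v1\<bar> \<le> b * norm u2 * norm v1"
      using Cauchy_Schwarz_ineq2[of "B u2" v1] mult_right_mono[OF B[of u2], of "norm v1"] by simp
    show "\<bar>inner (S1 u3) (R v1)\<bar> \<le> c * norm (S1 u3) * norm v1"
      using Cauchy_Schwarz_ineq2[of "S1 u3" "R v1"] mult_left_mono[OF R_bound[of v1], of "norm (S1 u3)"]
      by (simp add: ac_simps)
    have "\<bar>inner (S1 u1) (R u1)\<bar> \<le> c * norm u1 * norm (S1 u1)"
      using Cauchy_Schwarz_ineq2[of "S1 u1" "R u1"] mult_left_mono[OF R_bound[of u1], of "norm (S1 u1)"]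
      by (simp add: ac_simps)
    from mult_left_mono[OF this, of "\<bar>\<alpha>\<bar>"]
    show "\<bar>\<alpha>\<bar> * \<bar>inner (S1 u1) (R u1)\<bar> \<le> \<bar>\<alpha>\<bar> * c * norm u1 * norm (S1 u1)" by (simp add: mult.assoc)
  qed
  finally have main: "\<bar>\<alpha>\<bar> * (norm v1)\<^sup>2 \<le> sgn \<alpha> * F + norm u3 * norm v1 + b * norm u2 * norm v1
      + c * norm (S1 u3) * norm v1 + \<bar>\<alpha>\<bar> * c * norm u1 * norm (S1 u1)" by simp
  have coup: "- (\<alpha> * inner y z) \<le> \<bar>\<alpha>\<bar> * (norm y * norm z)" for y z :: 'a
    using Cauchy_Schwarz_ineq2[of y z] mult_left_mono[of "\<bar>inner y z\<bar>" "norm y * norm z" "\<bar>\<alpha>\<bar>"]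
      abs_ge_minus_self[of "\<alpha> * inner y z"] by (simp add: abs_mult)
  \<comment> \<open>The first equation at order 3 is tested with \<open>u3\<close>; \<open>g\<close>
    exchanges \<open>inner v3 u3\<close> for \<open>inner v1 u5\<close>, which involves only
    \<open>v1\<close> on the uncontrolled side.\<close>
  have s3: "(norm (S1 u3))\<^sup>2 \<le> norm u5 * norm u3 + b * (norm u4 * norm u3) - g + \<bar>\<alpha>\<bar> * (norm v1 * norm u5)"
    using CS[of u5 u3] CSB[of u4 u3] coup[of v1 u5]
    by (simp add: form1 mem eqs inner_diff_left g_def right_diff_distrib)
  have s1: "(norm (S1 u1))\<^sup>2 \<le> norm u3 * norm u1 + b * (norm u2 * norm u1) + \<bar>\<alpha>\<bar> * (norm v1 * norm u1)"
    using CS[of u3 u1] CSB[of u2 u1] coup[of v1 u1]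
    by (simp add: form1 mem eqs inner_diff_left)
  have "\<bar>\<alpha>\<bar> / 2 * (norm v1)\<^sup>2 \<le> sgn \<alpha> * F - 2 * c\<^sup>2 / \<bar>\<alpha>\<bar> * g + absorption_const b * observed x s"
    unfolding Q absorption_const_def
    by (rule multiplier_absorption[OF a b less_imp_le[OF c_pos] main s3 s1])
  then have "4 / \<bar>\<alpha>\<bar> * (\<bar>\<alpha>\<bar> / 2 * (norm v1)\<^sup>2)
      \<le> 4 / \<bar>\<alpha>\<bar> * (sgn \<alpha> * F - 2 * c\<^sup>2 / \<bar>\<alpha>\<bar> * g + absorption_const b * observed x s)"
    by (rule mult_left_mono) simp
  moreover have "4 / \<bar>\<alpha>\<bar> * (\<bar>\<alpha>\<bar> / 2 * (norm v1)\<^sup>2) = 2 * (norm v1)\<^sup>2" using a by simp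
  ultimately have v1: "2 * (norm v1)\<^sup>2 \<le> 4 / \<bar>\<alpha>\<bar> * (sgn \<alpha> * F - 2 * c\<^sup>2 / \<bar>\<alpha>\<bar> * g)
      + 4 / \<bar>\<alpha>\<bar> * absorption_const b * observed x s"
    by (simp only: distrib_left mult.assoc)
  have "T s x = (u0, u1, v0, v1)"
    using flow_components[OF chain _ s, of 0] by (simp add: u_defs v_defs)
  then have "2 * E (T s x) = inner (A1 u0) u0 + (norm u1)\<^sup>2 + inner (A2 v0) v0 + (norm v1)\<^sup>2 + 2 * \<alpha> * inner u0 v0"
    by (simp only: energy_eq form1 form2 mem)
  \<comment> \<open>Substituting the equations for \<open>A1 u0\<close> and \<open>A2 v0\<close>
    cancels the coupling and expresses the elastic energy by products with accelerations and
    damping.\<close>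
  also have "\<dots> = 2 * (norm u1)\<^sup>2 + 2 * (norm v1)\<^sup>2
      - ((norm u1)\<^sup>2 + inner u2 u0 + (norm v1)\<^sup>2 + inner v2 v0 + inner (B u1) u0)"
    by (simp add: eqs inner_diff_left inner_diff_right inner_commute)
  finally have "2 * E (T s x) = \<dots>" .
  moreover have "2 * (norm u1)\<^sup>2 \<le> 2 * observed x s" by (simp add: Q)
  moreover have "multiplier_deriv x s = 4 / \<bar>\<alpha>\<bar> * (sgn \<alpha> * F - 2 * c\<^sup>2 / \<bar>\<alpha>\<bar> * g)
      - ((norm u1)\<^sup>2 + inner u2 u0 + (norm v1)\<^sup>2 + inner v2 v0 + inner (B u1) u0)"
    unfolding multiplier_deriv_def u_folds F_def g_def ..
  ultimately show ?thesis using v1 by (simp only: distrib_right)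
qed

lemma power_in_Hsp: "k \<le> 4 \<Longrightarrow> (\<A> ^^ k) x \<in> Hsp DS1 DS2"
  using dom_sub[OF chain, of k] G_in[OF chain, of 3] by (cases "k = 4") (auto simp: eval_nat_numeral)

lemma energy_le_total: "k \<le> 4 \<Longrightarrow> E ((\<A> ^^ k) x) \<le> total_energy x"
  unfolding total_energy_def by (intro member_le_sum) (auto intro: energy_nonneg power_in_Hsp)

lemma multiplier_bound:
  assumes s: "0 \<le> s" and b: "0 \<le> b" and B: "\<And>u. norm (B u) \<le> b * norm u"
  shows "\<bar>multiplier x s\<bar> \<le> (2 + b / 2 + 4 / \<bar>\<alpha>\<bar> * (2 * c + 4 * c\<^sup>2)) * (2 / \<kappa> * (1 + 1 / \<omega>1 + 1 / \<omega>2) * total_energy x)"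
proof -
  \<comment> \<open>\<open>W\<close> dominates every squared norm in the multiplier: \<kappa> comes
    from energy coercivity, the reciprocals of \<omega>1 and \<omega>2 from bounding positions by
    their images under the roots.\<close>
  define W where "W = 2 / \<kappa> * (1 + 1 / \<omega>1 + 1 / \<omega>2) * total_energy x"
  have t0: "0 \<le> total_energy x" using energy_le_total[of 0] energy_nonneg[OF power_in_Hsp[of 0]] by simp
  have W: "y \<le> W" if "\<kappa> * y * m \<le> 2 * E ((\<A> ^^ k) x)" "m \<in> {1, \<omega>1, \<omega>2}" "k \<le> 3" for y m k
  proof -
    have m: "0 < m" "1 / m \<le> 1 + 1 / \<omega>1 + 1 / \<omega>2" using that(2) \<omega>1_pos \<omega>2_pos by auto
    have "\<kappa> * y * m \<le> 2 * total_energy x" using that(1,3) energy_le_total[of k] by simp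
    then have "y \<le> 2 / \<kappa> * (1 / m) * total_energy x" using \<kappa>_pos m(1) by (simp add: field_simps)
    also have "\<dots> \<le> W" unfolding W_def
      using m(2) \<kappa>_pos t0 by (intro mult_right_mono mult_left_mono) auto
    finally show ?thesis .
  qed
  note e = energy_state_bounds[OF chain _ s]
  have n: "(norm (du x 0 s))\<^sup>2 \<le> W" "(norm (du x 1 s))\<^sup>2 \<le> W" "(norm (du x 3 s))\<^sup>2 \<le> W"
    "(norm (du x 4 s))\<^sup>2 \<le> W" "(norm (dv x 0 s))\<^sup>2 \<le> W" "(norm (dv x 1 s))\<^sup>2 \<le> W"
    "(norm (dv x 2 s))\<^sup>2 \<le> W" "(norm (S1 (du x 1 s)))\<^sup>2 \<le> W" "(norm (S1 (du x 2 s)))\<^sup>2 \<le> W"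
    using W[OF e(1)[of 0]] W[OF e(1)[of 1]] W[OF e(1)[of 3]] W[of "(norm (du x 4 s))\<^sup>2" 1 3] e(4)[of 3]
      W[OF e(2)[of 0]] W[OF e(2)[of 1]] W[OF e(2)[of 2]]
      W[of "(norm (S1 (du x 1 s)))\<^sup>2" 1 1] W[of "(norm (S1 (du x 2 s)))\<^sup>2" 1 2] e(3)[of 1] e(3)[of 2]
    by (simp_all add: eval_nat_numeral)
  let ?F = "inner (S1 (du x 1 s)) (R (dv x 2 s)) - inner (S1 (du x 2 s)) (R (dv x 1 s))"
  let ?g = "inner (dv x 2 s) (du x 3 s) - inner (dv x 1 s) (du x 4 s)"
  let ?h = "inner (du x 1 s) (du x 0 s) + inner (dv x 1 s) (dv x 0 s) + inner (B (du x 0 s)) (du x 0 s) / 2"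
  have a: "0 < \<bar>\<alpha>\<bar>" using \<alpha>_nonzero by simp
  have c0: "0 \<le> c" using c_pos by simp
  have F: "\<bar>?F\<bar> \<le> 2 * (c * W)"
    using abs_inner_bounded_le[OF n(8) n(7) R_bound c0] abs_inner_bounded_le[OF n(9) n(6) R_bound c0]
    by linarith
  have g: "\<bar>?g\<bar> \<le> 2 * W"
    using abs_inner_le[OF n(7) n(3)] abs_inner_le[OF n(6) n(4)] by linarith
  have h: "\<bar>?h\<bar> \<le> W + W + b * W / 2"
    using abs_inner_le[OF n(2) n(1)] abs_inner_le[OF n(6) n(5)]
      abs_inner_bounded_le[OF n(1) n(1) B b] unfolding inner_commute[of "B _"] by linarith
  have "\<bar>sgn \<alpha> * ?F\<bar> \<le> 2 * (c * W)" using F by (simp add: abs_mult sgn_if)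
  moreover have "\<bar>2 * c\<^sup>2 / \<bar>\<alpha>\<bar> * (\<alpha> * ?g)\<bar> \<le> 2 * c\<^sup>2 * (2 * W)"
    using mult_left_mono[OF g, of "2 * c\<^sup>2"] a by (simp add: abs_mult)
  ultimately have "\<bar>sgn \<alpha> * ?F - 2 * c\<^sup>2 / \<bar>\<alpha>\<bar> * (\<alpha> * ?g)\<bar> \<le> 2 * (c * W) + 2 * c\<^sup>2 * (2 * W)"
    by linarith
  then have "4 / \<bar>\<alpha>\<bar> * \<bar>sgn \<alpha> * ?F - 2 * c\<^sup>2 / \<bar>\<alpha>\<bar> * (\<alpha> * ?g)\<bar>
      \<le> 4 / \<bar>\<alpha>\<bar> * (2 * (c * W) + 2 * c\<^sup>2 * (2 * W))"
    by (rule mult_left_mono) simp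
  then have "\<bar>4 / \<bar>\<alpha>\<bar> * (sgn \<alpha> * ?F - 2 * c\<^sup>2 / \<bar>\<alpha>\<bar> * (\<alpha> * ?g))\<bar>
      \<le> 4 / \<bar>\<alpha>\<bar> * (2 * (c * W) + 2 * c\<^sup>2 * (2 * W))"
    unfolding abs_mult[of "4 / \<bar>\<alpha>\<bar>"] by simp
  then have "\<bar>multiplier x s\<bar> \<le> 4 / \<bar>\<alpha>\<bar> * (2 * (c * W) + 2 * c\<^sup>2 * (2 * W)) + (W + W + b * W / 2)"
    unfolding multiplier_def using h by linarith
  also have "\<dots> = (2 + b / 2 + 4 / \<bar>\<alpha>\<bar> * (2 * c + 4 * c\<^sup>2)) * W" by (simp add: algebra_simps)
  finally show ?thesis unfolding W_def .
qed

lemma integral_observed: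
  assumes t: "0 \<le> t"
  shows "observed x integrable_on {0..t}" and "integral {0..t} (observed x) \<le> 4 / \<beta> * total_energy x"
proof -
  have cont: "continuous_on {0..t} (\<lambda>s. (norm (du x (Suc j) s))\<^sup>2)" if j: "j \<le> 4" for j
  proof -
    have "continuous_on {0..} (du x (Suc j))"
    proof (cases "j = 4")
      case True
      \<comment> \<open>The fifth derivative of \<open>u\<close> is a component of the orbit of the
        fourth iterate; continuity of orbits in the energy space suffices.\<close>
      have "du x (Suc j) = (\<lambda>s. fst (snd (J (T s ((\<A> ^^ 4) x)))))"
      proof
        show "du x (Suc j) s = fst (snd (J (T s ((\<A> ^^ 4) x))))" for s
          by (cases "T s ((\<A> ^^ 4) x)") (simp add: True du_def)
      qed
      then show ?thesis
        using J_orbit_continuous[OF power_in_Hsp[of 4]] by (auto intro!: continuous_on_fst continuous_on_snd)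
    next
      case False
      then show ?thesis unfolding continuous_on_eq_continuous_within
        using du_deriv[OF chain, of "Suc j"] j by (auto intro: has_vector_derivative_continuous)
    qed
    then have "continuous_on {0..t} (du x (Suc j))" by (rule continuous_on_subset) auto
    then show ?thesis by (intro continuous_on_power continuous_on_norm)
  qed
  then have int: "(\<lambda>s. (norm (du x (Suc j) s))\<^sup>2) integrable_on {0..t}" if "j \<in> {..4}" for j
    using that integrable_continuous_interval by auto
  show "observed x integrable_on {0..t}"
    unfolding observed_def[abs_def] by (intro integrable_sum int) auto
  have "integral {0..t} (observed x) = (\<Sum>j\<le>4. integral {0..t} (\<lambda>s. (norm (du x (Suc j) s))\<^sup>2))"
    unfolding observed_def[abs_def] by (intro integral_sum int) auto
  also have "\<dots> \<le> (\<Sum>j\<le>4. 4 / \<beta> * E ((\<A> ^^ j) x))"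
    using velocity_integral[OF chain _ t] \<beta>_pos by (intro sum_mono) (simp add: field_simps)
  also have "\<dots> = 4 / \<beta> * total_energy x" by (simp add: total_energy_def sum_distrib_left)
  finally show "integral {0..t} (observed x) \<le> 4 / \<beta> * total_energy x" .
qed

text \<open>Integration turns the multiplier derivative into endpoint values bounded independently
  of \<open>t\<close>, and the observed part is bounded by dissipation.\<close>

lemma integrated_energy:
  assumes t: "0 \<le> t" and b: "0 \<le> b" and B: "\<And>u. norm (B u) \<le> b * norm u"
  shows "integral {0..t} (\<lambda>s. E (T s x)) \<le>
    ((2 + b / 2 + 4 / \<bar>\<alpha>\<bar> * (2 * c + 4 * c\<^sup>2)) * (2 / \<kappa> * (1 + 1 / \<omega>1 + 1 / \<omega>2))
      + (1 + 2 / \<bar>\<alpha>\<bar> * absorption_const b) * (4 / \<beta>)) * total_energy x"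
proof -
  let ?C = "2 + 4 / \<bar>\<alpha>\<bar> * absorption_const b"
  \<comment> \<open>Matches the constants after the overall division by two, leaving the large
    coefficients unexpanded.\<close>
  have double: "2 * ((k * l + (1 + 2 / \<bar>\<alpha>\<bar> * m) * d) * y) = 2 * (k * (l * y)) + (2 + 4 / \<bar>\<alpha>\<bar> * m) * (d * y)"
    for k l m d y :: real by (simp add: distrib_left distrib_right mult.assoc)
  have x: "x \<in> \<D>" using chain[of 0] by simp
  have m: "(multiplier_deriv x has_integral multiplier x t - multiplier x 0) {0..t}"
  proof (rule fundamental_theorem_of_calculus[OF t])
    fix s assume "s \<in> {0..t}"
    then show "(multiplier x has_vector_derivative multiplier_deriv x s) (at s within {0..t})"
      using multiplier_has_derivative[of s]
      by (auto simp: has_real_derivative_iff_has_vector_derivative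
          intro: has_vector_derivative_within_subset)
  qed
  have o: "((\<lambda>s. ?C * observed x s) has_integral ?C * integral {0..t} (observed x)) {0..t}"
    using integrable_integral[OF integral_observed(1)[OF t]] by (rule has_integral_mult_right)
  have "continuous_on {0..} (\<lambda>s. E (T s x))"
    unfolding continuous_on_eq_continuous_within
    using energy_has_derivative[OF x] by (auto intro: DERIV_continuous)
  then have "continuous_on {0..t} (\<lambda>s. E (T s x))" by (rule continuous_on_subset) auto
  then have "((\<lambda>s. E (T s x)) has_integral integral {0..t} (\<lambda>s. E (T s x))) {0..t}"
    by (intro integrable_integral integrable_continuous_interval)
  then have e: "((\<lambda>s. 2 * E (T s x)) has_integral 2 * integral {0..t} (\<lambda>s. E (T s x))) {0..t}"
    by (rule has_integral_mult_right)
  have "2 * integral {0..t} (\<lambda>s. E (T s x)) \<le> multiplier x t - multiplier x 0 + ?C * integral {0..t} (observed x)"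
    using energy_le_multiplier_deriv[OF _ b B] by (intro has_integral_le[OF e has_integral_add[OF m o]]) auto
  also have "?C * integral {0..t} (observed x) \<le> ?C * (4 / \<beta> * total_energy x)"
    using integral_observed(2)[OF t] b by (intro mult_left_mono) (auto simp: absorption_const_def)
  also have "multiplier x t - multiplier x 0 \<le> \<bar>multiplier x t\<bar> + \<bar>multiplier x 0\<bar>" by simp
  also have "\<dots> \<le> 2 * ((2 + b / 2 + 4 / \<bar>\<alpha>\<bar> * (2 * c + 4 * c\<^sup>2)) * (2 / \<kappa> * (1 + 1 / \<omega>1 + 1 / \<omega>2) * total_energy x))"
    using multiplier_bound[OF t b B] multiplier_bound[OF order_refl b B] by linarith
  finally show ?thesis
    by (simp only: double[symmetric] mult_le_cancel_left_pos zero_less_numeral)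
qed

end

theorem integrated_energy_bound:
  "\<exists>c1>0. \<forall>x. (\<forall>k<4. (\<A> ^^ k) x \<in> \<D>) \<longrightarrow>
    (\<forall>t>0. integral {0..t} (\<lambda>s. E (T s x)) \<le> c1 * (\<Sum>k\<le>4. E ((\<A> ^^ k) x)))"
proof -
  \<comment> \<open>Fixing this bound before \<open>x\<close> and \<open>t\<close> makes
    \<open>c1\<close> depend only on the operators and the constants of the system.\<close>
  obtain b where b: "0 \<le> b" "\<And>u. norm (B u) \<le> b * norm u"
    using bounded_linear.nonneg_bounded[OF B_bl] by (auto simp: mult.commute)
  define c1 where "c1 = (2 + b / 2 + 4 / \<bar>\<alpha>\<bar> * (2 * c + 4 * c\<^sup>2)) * (2 / \<kappa> * (1 + 1 / \<omega>1 + 1 / \<omega>2))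
      + (1 + 2 / \<bar>\<alpha>\<bar> * absorption_const b) * (4 / \<beta>)"
  have "0 < (2 + b / 2 + 4 / \<bar>\<alpha>\<bar> * (2 * c + 4 * c\<^sup>2)) * (2 / \<kappa> * (1 + 1 / \<omega>1 + 1 / \<omega>2))"
    using b(1) c_pos \<kappa>_pos \<omega>1_pos \<omega>2_pos by (intro mult_pos_pos add_pos_nonneg) auto
  moreover have "0 \<le> (1 + 2 / \<bar>\<alpha>\<bar> * absorption_const b) * (4 / \<beta>)"
    using b(1) \<beta>_pos by (auto simp: absorption_const_def intro!: mult_nonneg_nonneg add_nonneg_nonneg)
  ultimately have "0 < c1" unfolding c1_def by (rule add_pos_nonneg)
  moreover have "integral {0..t} (\<lambda>s. E (T s x)) \<le> c1 * (\<Sum>k\<le>4. E ((\<A> ^^ k) x))"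
    if "\<forall>k<4. (\<A> ^^ k) x \<in> \<D>" "0 < t" for x t
    using integrated_energy[of x t b] that b unfolding c1_def total_energy_def by auto
  ultimately show ?thesis by blast
qed

end

theorem theorem3p2:
  fixes DA1 DA2 DS1 DS2 :: "'a::{real_inner, complete_space} set"
    and A1 A2 S1 S2 B :: "'a \<Rightarrow> 'a"
    and \<omega>1 \<omega>2 \<beta> \<alpha> c :: real
    and T :: "real \<Rightarrow> 'a st \<Rightarrow> 'a st"
  assumes A1_sa: "selfadjoint_op DA1 A1" and A1_closed: "closed_op DA1 A1"
    and A2_sa: "selfadjoint_op DA2 A2" and A2_closed: "closed_op DA2 A2"
    and \<omega>1_pos: "\<omega>1 > 0" and \<omega>2_pos: "\<omega>2 > 0"
    and A1_coer: "\<forall>u\<in>DA1. inner (A1 u) u \<ge> \<omega>1 * (norm u)\<^sup>2"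
    and A2_coer: "\<forall>u\<in>DA2. inner (A2 u) u \<ge> \<omega>2 * (norm u)\<^sup>2"
    and S1_sqrt: "is_sqrt_op DA1 A1 DS1 S1"
    and S2_sqrt: "is_sqrt_op DA2 A2 DS2 S2"
    and B_bl: "bounded_linear B"
    and B_sym: "\<forall>u v. inner (B u) v = inner u (B v)"
    and \<beta>_pos: "\<beta> > 0"
    and B_coer: "\<forall>u. inner (B u) u \<ge> \<beta> * (norm u)\<^sup>2"
    and \<alpha>_bounds: "0 < \<bar>\<alpha>\<bar>" "\<bar>\<alpha>\<bar> < sqrt (\<omega>1 * \<omega>2)"
    and T_gen: "C0_semigroup_gen (Hsp DS1 DS2) (hnorm S1 S2 \<alpha>) T
                  (opA_dom DA1 DS1 DA2 DS2) (opA A1 A2 B \<alpha>)"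
    and dom_incl: "DA2 \<subseteq> DS1"
    and c_pos: "c > 0"
    and S1_A2: "\<forall>u\<in>DA2. norm (S1 u) \<le> c * norm (A2 u)"
  shows "\<exists>c1>0. \<forall>U0. (\<forall>k<4. (opA A1 A2 B \<alpha> ^^ k) U0 \<in> opA_dom DA1 DS1 DA2 DS2) \<longrightarrow>
           (\<forall>t>0. integral {0..t} (\<lambda>s. energy S1 S2 \<alpha> (T s U0))
                   \<le> c1 * (\<Sum>k\<le>4. energy S1 S2 \<alpha> ((opA A1 A2 B \<alpha> ^^ k) U0)))"
proof -
  interpret coupled_system DA1 DA2 DS1 DS2 A1 A2 S1 S2 B \<omega>1 \<omega>2 \<beta> \<alpha> c T
    by (rule coupled_system.intro) (use assms in auto)
  show ?thesis by (rule integrated_energy_bound)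
qed

end
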